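(* Let $k\geq2$ be an integer and $\epsilon$ a positive real number. Suppose $\mu$ is a constant sum strong Rayleigh measure on $2^{[n]}$ such that $\mathbb{P}[S:i\in S]=\sum_{S\ni i}\mu(\{S\})\leq\epsilon$ for all $1\leq i\leq n$. Then there is a partition $S_1\cup\cdots\cup S_k=[n]$ such that $$\|\mathbf{e}_{S_i}\|=\lambda_{\max}(\mathbf{e}_{S_i})\leq\frac1k\,\delta(k\epsilon,n)$$ for each $1\leq i\leq k$, where $\delta(\alpha,n):=\Big(1-\frac1n+\sqrt{\alpha-\frac1n\big(1-\frac1n\big)}\Big)^2$.
   Context: A discrete probability measure $\mu$ on $2^{[n]}$ has multivariate partition function $P_\mu(\mathbf{x})=\sum_{S\subseteq[n]}\mu(\{S\})\prod_{j\in S}x_j$; $\mu$ is strong Rayleigh if $P_\mu(\mathbf{x})\neq0$ whenever $\operatorname{Im}(x_j)>0$ for all $j$, and of constant sum $d$ if $|S|=d$ whenever $\mu(\{S\})\neq0$. For a constant sum strong Rayleigh $\mu$, $P_\mu$ is a homogeneous polynomial hyperbolic with respect to the all-ones vector $\mathbf{1}$ (i.e. $P_\mu(\mathbf{1})\neq0$ and $t\mapsto P_\mu(t\mathbf{1}-\mathbf{x})$ is real-rooted for all real $\mathbf{x}$); eigenvalues $\lambda_1(\mathbf{x})\geq\cdots\geq\lambda_d(\mathbf{x})$ are defined by $P_\mu(t\mathbf{1}-\mathbf{x})=P_\mu(\mathbf{1})\prod_j(t-\lambda_j(\mathbf{x}))$, $\lambda_{\max}=\lambda_1$, $\|\mathbf{x}\|=\max_j|\lambda_j(\mathbf{x})|$.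 $\mathbf{e}_i$ is the $i$-th standard basis vector of $\mathbb{R}^n$ and $\mathbf{e}_S=\sum_{i\in S}\mathbf{e}_i$. *)

theory Defs
  imports Complex_Main
begin

text \<open>Ground set [n] = {1..n}. A discrete measure on 2^[n] is a function
  mu :: nat set => real, considered on Pow {1..n}. Vectors in R^n / C^n are
  functions nat => real / nat => complex, only their values on {1..n} matter.\<close>

definition prob_measure_on :: "nat \<Rightarrow> (nat set \<Rightarrow> real) \<Rightarrow> bool" where
  "prob_measure_on n mu \<longleftrightarrow>
     (\<forall>S\<in>Pow {1..n}. 0 \<le> mu S) \<and> (\<Sum>S\<in>Pow {1..n}. mu S) = 1"

definition partition_fun :: "nat \<Rightarrow> (nat set \<Rightarrow> real) \<Rightarrow> (nat \<Rightarrow> complex) \<Rightarrow> complex" where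
  "partition_fun n mu z = (\<Sum>S\<in>Pow {1..n}. complex_of_real (mu S) * (\<Prod>j\<in>S. z j))"

definition partition_fun_real :: "nat \<Rightarrow> (nat set \<Rightarrow> real) \<Rightarrow> (nat \<Rightarrow> real) \<Rightarrow> real" where
  "partition_fun_real n mu x = (\<Sum>S\<in>Pow {1..n}. mu S * (\<Prod>j\<in>S. x j))"

definition strong_rayleigh :: "nat \<Rightarrow> (nat set \<Rightarrow> real) \<Rightarrow> bool" where
  "strong_rayleigh n mu \<longleftrightarrow>
     (\<forall>z. (\<forall>j\<in>{1..n}. Im (z j) > 0) \<longrightarrow> partition_fun n mu z \<noteq> 0)"

definition constant_sum :: "nat \<Rightarrow> (nat set \<Rightarrow> real) \<Rightarrow> nat \<Rightarrow> bool" where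
  "constant_sum n mu d \<longleftrightarrow> (\<forall>S\<in>Pow {1..n}. mu S \<noteq> 0 \<longrightarrow> card S = d)"

text \<open>The eigenvalues of x (w.r.t. the hyperbolic polynomial P_mu and direction 1)
  are the roots of t |-> P_mu(t 1 - x); as a set (multiplicities are irrelevant
  for max and max-abs).\<close>
definition eigenvalues :: "nat \<Rightarrow> (nat set \<Rightarrow> real) \<Rightarrow> (nat \<Rightarrow> real) \<Rightarrow> real set" where
  "eigenvalues n mu x = {t. partition_fun_real n mu (\<lambda>j. t - x j) = 0}"

text \<open>Largest eigenvalue (convention 0 if there are no eigenvalues, i.e. d = 0).\<close>
definition lambda_max :: "nat \<Rightarrow> (nat set \<Rightarrow> real) \<Rightarrow> (nat \<Rightarrow> real) \<Rightarrow> real" where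
  "lambda_max n mu x = (if eigenvalues n mu x = {} then 0 else Max (eigenvalues n mu x))"

definition hnorm :: "nat \<Rightarrow> (nat set \<Rightarrow> real) \<Rightarrow> (nat \<Rightarrow> real) \<Rightarrow> real" where
  "hnorm n mu x = (if eigenvalues n mu x = {} then 0 else Max (abs ` eigenvalues n mu x))"

definition e_set :: "nat set \<Rightarrow> nat \<Rightarrow> real" where
  "e_set S = (\<lambda>j. if j \<in> S then 1 else 0)"

definition delta :: "real \<Rightarrow> nat \<Rightarrow> real" where
  "delta \<alpha> n = (1 - 1 / real n + sqrt (\<alpha> - 1 / real n * (1 - 1 / real n)))\<^sup>2"

end

theory Submission
  imports Defs "HOL-Analysis.Analysis" "HOL-Computational_Algebra.Fundamental_Theorem_Algebra"
begin

text \<open>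
  For each \<open>i\<close> take a copy of \<open>P\<^sub>\<mu>\<close> and let \<open>G\<close> be the product of the \<open>k\<close> copies. As \<open>P\<^sub>\<mu>\<close> is affine in each
  variable, assigning \<open>j\<close> to the \<open>i\<close>-th block shifts the \<open>j\<close>-th variable of the \<open>i\<close>-th copy by \<open>- k\<close>, and the
  average over all assignments is \<open>(1 - D\<^sub>1) \<dots> (1 - D\<^sub>n) G\<close>, where \<open>D\<^sub>j\<close> is the sum over the copies of the
  derivatives in the \<open>j\<close>-th variable. With parameters, \<open>(1 - y\<^sub>1 D\<^sub>1) \<dots> (1 - y\<^sub>n D\<^sub>n) G\<close> is a hyperbolic
  polynomial in \<open>x\<close> and \<open>y\<close>, so by Garding its hyperbolicity cone is convex. Convexity makes \<open>D\<^sub>i f / f\<close> convex on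
  the cone, which drives the barrier argument: once the barriers are bounded, a parameter \<open>y\<^sub>j\<close> can be raised
  from \<open>0\<close> to \<open>1\<close> at the price of a shift by \<open>s\<close> in the direction \<open>D\<^sub>j\<close>. Raising all parameters but the
  last and averaging over the choice of the last one gives the bound \<open>\<delta>\<close> for the average. Finally, choosing
  the blocks one element at a time, some choice keeps the point in the cone, as the average of the values
  over the choices is positive and the polynomial is affine along each shift.
\<close>

section \<open>Polynomial functions with real coefficients\<close>

text \<open>Polynomials are kept as functions, so that shifts and restrictions to lines are plain
  compositions, and conjugation symmetry and continuity are inductions on the construction.\<close>

inductive real_polyfun :: "(('i \<Rightarrow> complex) \<Rightarrow> complex) \<Rightarrow> bool" where
  const: "real_polyfun (\<lambda>w. complex_of_real c)"
| coord: "real_polyfun (\<lambda>w. w i)"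
| add: "real_polyfun f \<Longrightarrow> real_polyfun g \<Longrightarrow> real_polyfun (\<lambda>w. f w + g w)"
| mult: "real_polyfun f \<Longrightarrow> real_polyfun g \<Longrightarrow> real_polyfun (\<lambda>w. f w * g w)"

lemma real_polyfun_sum:
  assumes "\<And>a. a \<in> A \<Longrightarrow> real_polyfun (f a)"
  shows "real_polyfun (\<lambda>w. \<Sum>a\<in>A. f a w)"
  using assms
proof (induction A rule: infinite_finite_induct)
  case (insert x A)
  then show ?case by (simp add: real_polyfun.add)
qed (use real_polyfun.const[of 0] in simp_all)

lemma real_polyfun_prod:
  assumes "\<And>a. a \<in> A \<Longrightarrow> real_polyfun (f a)"
  shows "real_polyfun (\<lambda>w. \<Prod>a\<in>A. f a w)"
  using assms
proof (induction A rule: infinite_finite_induct)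
  case (insert x A)
  then show ?case by (simp add: real_polyfun.mult)
qed (use real_polyfun.const[of 1] in simp_all)

lemma real_polyfun_subst:
  assumes "real_polyfun F" "\<And>i. real_polyfun (\<lambda>w. h w i)"
  shows "real_polyfun (\<lambda>w. F (h w))"
  using assms by induction (auto intro: real_polyfun.intros)

lemma real_polyfun_cnj:
  "real_polyfun F \<Longrightarrow> F (\<lambda>i. cnj (w i)) = cnj (F w)"
  by (induction rule: real_polyfun.induct) auto

lemma real_polyfun_line:
  "real_polyfun F \<Longrightarrow> \<exists>p. \<forall>\<sigma>. F (\<lambda>i. z i + \<sigma> * a i) = poly p \<sigma>"
proof (induction rule: real_polyfun.induct)
  case (const c)
  show ?case by (rule exI[of _ "[:complex_of_real c:]"]) simp
next
  case (coord i)
  show ?case by (rule exI[of _ "[:z i, a i:]"]) (simp add: mult.commute)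
next
  case (add f g)
  then obtain p q where "\<forall>\<sigma>. f (\<lambda>i. z i + \<sigma> * a i) = poly p \<sigma>"
    "\<forall>\<sigma>. g (\<lambda>i. z i + \<sigma> * a i) = poly q \<sigma>" by blast
  then show ?case by (intro exI[of _ "p + q"]) simp
next
  case (mult f g)
  then obtain p q where "\<forall>\<sigma>. f (\<lambda>i. z i + \<sigma> * a i) = poly p \<sigma>"
    "\<forall>\<sigma>. g (\<lambda>i. z i + \<sigma> * a i) = poly q \<sigma>" by blast
  then show ?case by (intro exI[of _ "p * q"]) simp
qed

lemma real_polyfun_continuous_on:
  assumes "real_polyfun F" "\<And>i. continuous_on A (\<lambda>x. h x i)"
  shows "continuous_on A (\<lambda>x. F (h x))"
  using assms by induction (auto intro: continuous_intros)

text \<open>Additivity in the direction later splits the derivative along \<open>var_dir j\<close>,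
  a sum of unit vectors, into one contribution per copy.\<close>

lemma real_polyfun_differential:
  assumes "real_polyfun F"
  obtains G where
    "\<And>w v. ((\<lambda>r::real. F (\<lambda>i. w i + of_real r * v i)) has_vector_derivative G w v) (at 0)"
    "\<And>w u v. G w (\<lambda>i. u i + v i) = G w u + G w v"
proof -
  have "\<exists>G. (\<forall>w v. ((\<lambda>r::real. F (\<lambda>i. w i + of_real r * v i)) has_vector_derivative G w v) (at 0))
      \<and> (\<forall>w u v. G w (\<lambda>i. u i + v i) = G w u + G w v)"
    using assms
  proof induction
    case (const c)
    show ?case by (rule exI[of _ "\<lambda>w v. 0"]) (auto intro: derivative_eq_intros)
  next
    case (coord i)
    show ?case
      by (rule exI[of _ "\<lambda>w v. v i"])
         (auto intro!: derivative_eq_intros has_vector_derivative_of_real)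
  next
    case (add f g)
    then obtain G H where
      "\<forall>w v. ((\<lambda>r::real. f (\<lambda>i. w i + of_real r * v i)) has_vector_derivative G w v) (at 0)"
      "\<forall>w u v. G w (\<lambda>i. u i + v i) = G w u + G w v"
      "\<forall>w v. ((\<lambda>r::real. g (\<lambda>i. w i + of_real r * v i)) has_vector_derivative H w v) (at 0)"
      "\<forall>w u v. H w (\<lambda>i. u i + v i) = H w u + H w v" by blast
    then show ?case
      by (intro exI[of _ "\<lambda>w v. G w v + H w v"]) (auto intro: has_vector_derivative_add)
  next
    case (mult f g)
    then obtain G H where
      "\<forall>w v. ((\<lambda>r::real. f (\<lambda>i. w i + of_real r * v i)) has_vector_derivative G w v) (at 0)"
      "\<forall>w u v. G w (\<lambda>i. u i + v i) = G w u + G w v"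
      "\<forall>w v. ((\<lambda>r::real. g (\<lambda>i. w i + of_real r * v i)) has_vector_derivative H w v) (at 0)"
      "\<forall>w u v. H w (\<lambda>i. u i + v i) = H w u + H w v" by blast
    moreover from this have "((\<lambda>r::real. f (\<lambda>i. w i + of_real r * v i) * g (\<lambda>i. w i + of_real r * v i))
        has_vector_derivative f w * H w v + G w v * g w) (at 0)" for w v
      using has_vector_derivative_mult[of "\<lambda>r::real. f (\<lambda>i. w i + of_real r * v i)" "G w v" 0 UNIV
          "\<lambda>r. g (\<lambda>i. w i + of_real r * v i)" "H w v"] by simp
    ultimately show ?case
      by (intro exI[of _ "\<lambda>w v. f w * H w v + G w v * g w"]) (auto simp: algebra_simps)
  qed
  then show thesis using that by blast
qed

section \<open>Zero-free half planes under homotopy\<close>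

text \<open>Split off the roots one at a time: each factor \<open>\<sigma> - z\<close> has modulus
  at least \<open>Im \<sigma>\<close>. The bound does not see where the roots lie, so it survives
  limits with fixed degree and leading coefficient.\<close>

lemma norm_poly_ge_if_roots_lower_half_plane:
  fixes p :: "complex poly"
  assumes "\<And>z. poly p z = 0 \<Longrightarrow> Im z < 0" "Im \<sigma> \<ge> 0"
  shows "norm (poly p \<sigma>) \<ge> norm (lead_coeff p) * Im \<sigma> ^ degree p"
  using assms(1)
proof (induction "degree p" arbitrary: p)
  case 0
  then obtain c where "p = [:c:]" using degree_eq_zeroE by metis
  then show ?case by simp
next
  case (Suc m)
  then have "\<not> constant (poly p)" by (simp add: constant_degree)
  then obtain z where z: "poly p z = 0" using fundamental_theorem_of_algebra by blast
  then obtain q where q: "p = [:-z, 1:] * q" using poly_eq_0_iff_dvd dvdE by metis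
  with Suc have "q \<noteq> 0" by auto
  then have deg: "degree p = Suc (degree q)" and lc: "lead_coeff p = lead_coeff q"
    using degree_mult_eq[of "[:-z, 1:]" q] lead_coeff_mult[of "[:-z, 1:]" q] by (simp_all add: q del: mult_pCons_left)
  have "Im z < 0" using Suc z by blast
  then have "Im \<sigma> \<le> norm (\<sigma> - z)" using abs_Im_le_cmod[of "\<sigma> - z"] by simp
  moreover have "norm (poly q \<sigma>) \<ge> norm (lead_coeff q) * Im \<sigma> ^ degree q"
    using Suc(2) deg by (intro Suc(1)) (auto simp: q intro: Suc(3))
  ultimately have "Im \<sigma> * (norm (lead_coeff q) * Im \<sigma> ^ degree q) \<le> norm (\<sigma> - z) * norm (poly q \<sigma>)"
    using assms(2) by (intro mult_mono) auto
  moreover have "poly p \<sigma> = (\<sigma> - z) * poly q \<sigma>" by (simp add: q algebra_simps)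
  ultimately show ?case unfolding lc by (simp add: deg norm_mult mult_ac)
qed

text \<open>A polynomial whose roots move continuously without meeting the real axis keeps them in the
  lower half plane: roots cannot escape to infinity because the leading coefficient \<open>F b\<close> is fixed.\<close>

lemma homogeneous_polyfun_homotopy:
  fixes F :: "('i \<Rightarrow> complex) \<Rightarrow> complex"
  assumes pf: "real_polyfun F" and hom: "\<And>c w. F (\<lambda>i. c * w i) = c ^ D * F w"
    and b: "F b \<noteq> 0"
    and real: "\<And>s x :: real. 0 \<le> s \<Longrightarrow> s \<le> 1 \<Longrightarrow>
      F (\<lambda>i. (1 - of_real s) * u i + of_real s * v i + of_real x * b i) \<noteq> 0"
    and start: "\<And>\<sigma>. Im \<sigma> \<ge> 0 \<Longrightarrow> F (\<lambda>i. u i + \<sigma> * b i) \<noteq> 0"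
    and \<sigma>: "Im \<sigma> \<ge> 0"
  shows "F (\<lambda>i. v i + \<sigma> * b i) \<noteq> 0"
proof -
  define zs where "zs s i = (1 - of_real s) * u i + of_real s * v i" for s i
  define bad where "bad = {s\<in>{0..1}. \<exists>\<sigma>. Im \<sigma> \<ge> 0 \<and> F (\<lambda>i. zs s i + \<sigma> * b i) = 0}"
  \<comment> \<open>Passing to \<open>inverse \<sigma>\<close> brings infinity to the origin, where
    the value is \<open>F b \<noteq> 0\<close>; compactness then bounds all roots uniformly in
    \<open>s\<close>.\<close>
  have inv: "F (\<lambda>i. zs s i + \<sigma> * b i) = \<sigma> ^ D * F (\<lambda>i. b i + inverse \<sigma> * zs s i)"
    if "\<sigma> \<noteq> 0" for s \<sigma>
  proof -
    have "(\<lambda>i. zs s i + \<sigma> * b i) = (\<lambda>i. \<sigma> * (b i + inverse \<sigma> * zs s i))"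
      using that by (simp add: fun_eq_iff field_simps)
    then show ?thesis using hom[of \<sigma> "\<lambda>i. b i + inverse \<sigma> * zs s i"] by simp
  qed
  have "closed ({0..1::real} \<times> cball (0::complex) 1 \<inter> (\<lambda>x. F (\<lambda>i. b i + snd x * zs (fst x) i)) -` {0})"
    unfolding zs_def
    by (intro continuous_closed_preimage real_polyfun_continuous_on[OF pf])
       (auto intro!: continuous_intros closed_Times)
  moreover have "bounded ({0..1::real} \<times> cball (0::complex) 1)"
    by (intro bounded_Times) auto
  ultimately have "compact ({0..1::real} \<times> cball (0::complex) 1 \<inter> (\<lambda>x. F (\<lambda>i. b i + snd x * zs (fst x) i)) -` {0})"
    (is "compact ?K") by (simp add: compact_eq_bounded_closed bounded_Int)
  then have "compact (snd ` ?K)" by (intro compact_continuous_image continuous_intros)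
  moreover have "0 \<notin> snd ` ?K" using b by auto
  ultimately have "\<exists>\<delta>>0. \<forall>\<tau>\<in>snd ` ?K. \<delta> \<le> dist 0 \<tau>"
    by (intro separate_point_closed compact_imp_closed)
  then obtain \<delta> where \<delta>: "\<delta> > 0" "\<And>\<tau>. \<tau> \<in> snd ` ?K \<Longrightarrow> \<delta> \<le> dist 0 \<tau>"
    by blast
  define B where "B = max 1 (inverse \<delta>)"
  have bound: "norm \<sigma> \<le> B" if "s \<in> {0..1}" "F (\<lambda>i. zs s i + \<sigma> * b i) = 0" for s \<sigma>
  proof (rule ccontr)
    assume "\<not> norm \<sigma> \<le> B"
    then have g: "norm \<sigma> > 1" "norm \<sigma> > inverse \<delta>" by (auto simp: B_def)
    then have "\<sigma> \<noteq> 0" by auto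
    then have "F (\<lambda>i. b i + inverse \<sigma> * zs s i) = 0" using that inv by simp
    then have "inverse \<sigma> \<in> snd ` ?K"
      using that g by (intro image_eqI[of _ _ "(s, inverse \<sigma>)"]) (auto simp: norm_inverse inverse_le_1_iff)
    from \<delta>(2)[OF this] have "\<delta> \<le> inverse (norm \<sigma>)" by (simp add: norm_inverse)
    moreover have "inverse (norm \<sigma>) < \<delta>"
      using less_imp_inverse_less[OF g(2)] \<delta>(1) by simp
    ultimately show False by simp
  qed
  \<comment> \<open>Outside \<open>bad\<close> all roots lie in the open lower half plane, and
    growth at infinity identifies the degree \<open>D\<close> and the leading coefficient
    \<open>F b\<close>, so the bound is the same for all such \<open>s\<close>.\<close>
  have lower: "norm (F (\<lambda>i. zs s i + \<sigma> * b i)) \<ge> norm (F b) * Im \<sigma> ^ D"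
    if s: "s \<in> {0..1} - bad" "Im \<sigma> \<ge> 0" for s \<sigma>
  proof -
    obtain p where p: "\<And>\<sigma>. F (\<lambda>i. zs s i + \<sigma> * b i) = poly p \<sigma>"
      using real_polyfun_line[OF pf] by blast
    have roots: "Im z < 0" if "poly p z = 0" for z
    proof (rule ccontr)
      assume "\<not> Im z < 0"
      then have "s \<in> bad" using s(1) that by (auto simp: bad_def p intro!: exI[of _ z])
      then show False using s(1) by simp
    qed
    have nz: "eventually (\<lambda>\<sigma>::complex. \<sigma> \<noteq> 0) at_infinity"
      by (auto simp: eventually_at_infinity intro!: exI[of _ 1])
    have cont: "continuous_on UNIV (\<lambda>\<tau>. F (\<lambda>i. b i + \<tau> * zs s i))"
      by (intro real_polyfun_continuous_on[OF pf] continuous_intros)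
    have "isCont (\<lambda>\<tau>. F (\<lambda>i. b i + \<tau> * zs s i)) 0"
      using cont by (simp add: continuous_on_eq_continuous_at)
    from isCont_tendsto_compose[OF this tendsto_inverse_0]
    have "((\<lambda>\<sigma>. F (\<lambda>i. b i + inverse \<sigma> * zs s i)) \<longlongrightarrow> F b) at_infinity"
      by simp
    moreover have "eventually (\<lambda>\<sigma>. F (\<lambda>i. b i + inverse \<sigma> * zs s i) = poly p \<sigma> / \<sigma> ^ D) at_infinity"
      using nz by eventually_elim (simp add: inv flip: p)
    ultimately have l1: "((\<lambda>\<sigma>. poly p \<sigma> / \<sigma> ^ D) \<longlongrightarrow> F b) at_infinity"
      by (rule Lim_transform_eventually)
    have l2: "((\<lambda>\<sigma>. poly p \<sigma> / \<sigma> ^ degree p) \<longlongrightarrow> lead_coeff p) at_infinity"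
      by (rule poly_divide_tendsto_aux)
    have "p \<noteq> 0" using roots[of 0] by auto
    have "degree p = D"
    proof (rule ccontr)
      assume ne: "degree p \<noteq> D"
      have z: "((\<lambda>\<sigma>::complex. inverse \<sigma> ^ m) \<longlongrightarrow> 0) at_infinity" if "m > 0" for m
        using tendsto_power[OF tendsto_inverse_0, of m] that by (simp add: power_0_left)
      show False
      proof (cases "degree p < D")
        case True
        have "((\<lambda>\<sigma>. poly p \<sigma> / \<sigma> ^ degree p * inverse \<sigma> ^ (D - degree p)) \<longlongrightarrow> lead_coeff p * 0) at_infinity"
          using True by (intro tendsto_mult l2 z) auto
        moreover have "eventually (\<lambda>\<sigma>. poly p \<sigma> / \<sigma> ^ degree p * inverse \<sigma> ^ (D - degree p)
            = poly p \<sigma> / \<sigma> ^ D) at_infinity"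
          using nz by eventually_elim (use True in \<open>simp add: power_diff field_simps\<close>)
        ultimately have "((\<lambda>\<sigma>. poly p \<sigma> / \<sigma> ^ D) \<longlongrightarrow> lead_coeff p * 0) at_infinity"
          by (rule Lim_transform_eventually)
        from tendsto_unique[OF trivial_limit_at_infinity l1 this] show False using b by simp
      next
        case False
        have "((\<lambda>\<sigma>. poly p \<sigma> / \<sigma> ^ D * inverse \<sigma> ^ (degree p - D)) \<longlongrightarrow> F b * 0) at_infinity"
          using False ne by (intro tendsto_mult l1 z) auto
        moreover have "eventually (\<lambda>\<sigma>. poly p \<sigma> / \<sigma> ^ D * inverse \<sigma> ^ (degree p - D)
            = poly p \<sigma> / \<sigma> ^ degree p) at_infinity"
          using nz by eventually_elim (use False in \<open>simp add: power_diff field_simps\<close>)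
        ultimately have "((\<lambda>\<sigma>. poly p \<sigma> / \<sigma> ^ degree p) \<longlongrightarrow> F b * 0) at_infinity"
          by (rule Lim_transform_eventually)
        from tendsto_unique[OF trivial_limit_at_infinity l2 this] show False using \<open>p \<noteq> 0\<close> by simp
      qed
    qed
    moreover from this have "lead_coeff p = F b"
      using tendsto_unique[OF trivial_limit_at_infinity l2] l1 by simp
    ultimately show ?thesis
      using norm_poly_ge_if_roots_lower_half_plane[of p \<sigma>, OF roots s(2)] by (simp add: p)
  qed
  have "closed bad"
  proof -
    have "closed (({0..1::real} \<times> (cball (0::complex) B \<inter> {\<sigma>. Im \<sigma> \<ge> 0}))
        \<inter> (\<lambda>x. F (\<lambda>i. zs (fst x) i + snd x * b i)) -` {0})" (is "closed ?K2")
      unfolding zs_def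
      by (intro continuous_closed_preimage real_polyfun_continuous_on[OF pf])
         (auto intro!: continuous_intros closed_Times closed_halfspace_Im_ge closed_Int)
    moreover have "bounded ({0..1::real} \<times> (cball (0::complex) B \<inter> {\<sigma>. Im \<sigma> \<ge> 0}))"
      by (intro bounded_Times bounded_Int) auto
    ultimately have "compact ?K2" by (simp add: compact_eq_bounded_closed bounded_Int)
    then have "compact (fst ` ?K2)" by (intro compact_continuous_image continuous_intros)
    moreover have "fst ` ?K2 = bad"
      using bound by (auto simp: bad_def image_iff Bex_def) blast
    ultimately show ?thesis by (simp add: compact_imp_closed)
  qed
  \<comment> \<open>In the limit a real root is excluded by \<open>real\<close>, and a root above
    the axis by the uniform bound \<open>lower\<close>. As \<open>bad\<close> is closed too,
    connectedness leaves it empty, since \<open>0\<close> is not in it.\<close>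
  moreover have "closed ({0..1} - bad)"
  proof (unfold closed_sequential_limits, intro allI impI, elim conjE)
    fix x l assume x: "\<forall>n. x n \<in> {0..1} - bad" and lim: "x \<longlonglongrightarrow> l"
    have l01: "l \<in> {0..1}"
      using x by (intro closed_sequentially[OF closed_atLeastAtMost _ lim]) auto
    have "F (\<lambda>i. zs l i + \<sigma> * b i) \<noteq> 0" if \<sigma>: "Im \<sigma> \<ge> 0" for \<sigma>
    proof (cases "Im \<sigma> = 0")
      case True
      then have "\<sigma> = of_real (Re \<sigma>)" by (simp add: complex_eq_iff)
      then show ?thesis using real[of l "Re \<sigma>"] l01 by (simp add: zs_def)
    next
      case False
      have "continuous_on UNIV (\<lambda>s. F (\<lambda>i. zs s i + \<sigma> * b i))"
        unfolding zs_def by (intro real_polyfun_continuous_on[OF pf] continuous_intros)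
      then have "(\<lambda>n. F (\<lambda>i. zs (x n) i + \<sigma> * b i)) \<longlonglongrightarrow> F (\<lambda>i. zs l i + \<sigma> * b i)"
        by (rule continuous_on_tendsto_compose[OF _ lim]) auto
      then have "(\<lambda>n. norm (F (\<lambda>i. zs (x n) i + \<sigma> * b i))) \<longlonglongrightarrow> norm (F (\<lambda>i. zs l i + \<sigma> * b i))"
        by (rule tendsto_norm)
      then have "norm (F (\<lambda>i. zs l i + \<sigma> * b i)) \<ge> norm (F b) * Im \<sigma> ^ D"
        using lower x \<sigma> by (intro LIMSEQ_le_const) auto
      moreover have "norm (F b) * Im \<sigma> ^ D > 0" using False \<sigma> b by simp
      ultimately show ?thesis by auto
    qed
    then show "l \<in> {0..1} - bad" using l01 by (auto simp: bad_def)
  qed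
  moreover have "connected {0..1::real}" by simp
  ultimately have "bad \<inter> {0..1} = {} \<or> ({0..1} - bad) \<inter> {0..1} = {}"
    by (intro connected_closedD) (auto simp: bad_def)
  moreover have "0 \<in> {0..1} - bad" using start by (auto simp: bad_def zs_def)
  moreover have "1 \<in> {0..1::real}" by simp
  ultimately have "1 \<notin> bad" by blast
  then show ?thesis using \<sigma> by (auto simp: bad_def zs_def)
qed

section \<open>Convexity of the hyperbolicity cone\<close>

text \<open>\<open>hyp\<close> is real-rootedness along \<open>e\<close>; as the coefficients are
  real, conjugation carries it to the lower half plane (\<open>hyp'\<close>). \<open>Fe\<close>
  fixes the sign that \<open>val\<close> has on the cone.\<close>

locale hyperbolic_polyfun =
  fixes F :: "('i \<Rightarrow> complex) \<Rightarrow> complex" and D :: nat and e :: "'i \<Rightarrow> real"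
  assumes pf: "real_polyfun F"
    and hom: "F (\<lambda>i. c * w i) = c ^ D * F w"
    and hyp: "Im \<sigma> > 0 \<Longrightarrow> F (\<lambda>i. complex_of_real (z i) + \<sigma> * complex_of_real (e i)) \<noteq> 0"
    and Fe: "Re (F (\<lambda>i. complex_of_real (e i))) > 0"
begin

definition val :: "('i \<Rightarrow> real) \<Rightarrow> real" where
  "val a = Re (F (\<lambda>i. complex_of_real (a i)))"

lemma of_real_val: "F (\<lambda>i. complex_of_real (a i)) = complex_of_real (val a)"
proof -
  have "Im (F (\<lambda>i. complex_of_real (a i))) = 0"
    using real_polyfun_cnj[OF pf, of "\<lambda>i. complex_of_real (a i)"] by (simp add: complex_eq_iff)
  then show ?thesis by (simp add: val_def complex_eq_iff)
qed

lemma val_eq_0_iff: "F (\<lambda>i. complex_of_real (a i)) = 0 \<longleftrightarrow> val a = 0"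
  by (simp add: of_real_val)

lemma val_scale: "val (\<lambda>i. c * a i) = c ^ D * val a"
  using hom[of "of_real c" "\<lambda>i. of_real (a i)"] unfolding val_def by (simp flip: of_real_power)

lemma continuous_on_val:
  assumes "\<And>i. continuous_on A (\<lambda>x. h x i)"
  shows "continuous_on A (\<lambda>x. val (h x))"
  unfolding val_def
  by (intro continuous_intros real_polyfun_continuous_on[OF pf] assms)

lemma hyp':
  assumes "Im \<sigma> \<noteq> 0"
  shows "F (\<lambda>i. complex_of_real (z i) + \<sigma> * complex_of_real (e i)) \<noteq> 0"
proof (cases "Im \<sigma> > 0")
  case False
  then have "F (\<lambda>i. complex_of_real (z i) + cnj \<sigma> * complex_of_real (e i)) \<noteq> 0"
    using assms by (intro hyp) simp
  then show ?thesis
    using real_polyfun_cnj[OF pf, of "\<lambda>i. complex_of_real (z i) + \<sigma> * complex_of_real (e i)"] by auto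
qed (rule hyp)

text \<open>Garding's open hyperbolicity cone: the roots in \<open>l\<close> are real by
  \<open>hyp'\<close>, and here all of them are negative.\<close>

definition cone :: "('i \<Rightarrow> real) set" where
  "cone = {a. \<forall>l\<ge>0. val (\<lambda>i. a i + l * e i) \<noteq> 0}"

lemma cone_val_nonzero: "a \<in> cone \<Longrightarrow> val a \<noteq> 0"
  unfolding cone_def by (auto dest: spec[of _ 0])

lemma cone_add_direction: "a \<in> cone \<Longrightarrow> r \<ge> 0 \<Longrightarrow> (\<lambda>i. a i + r * e i) \<in> cone"
  unfolding cone_def
  by (auto simp: add.assoc simp flip: distrib_right)

lemma cone_scale:
  assumes "a \<in> cone" "c > 0"
  shows "(\<lambda>i. c * a i) \<in> cone"
  unfolding cone_def
proof (intro CollectI allI impI)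
  fix l :: real assume "l \<ge> 0"
  then have "l / c \<ge> 0" using assms by simp
  then have "val (\<lambda>i. a i + l / c * e i) \<noteq> 0" using assms(1) unfolding cone_def by blast
  then have "val (\<lambda>i. c * (a i + l / c * e i)) \<noteq> 0" using assms unfolding val_scale by simp
  then show "val (\<lambda>i. c * a i + l * e i) \<noteq> 0" using assms by (simp add: distrib_left)
qed

lemma direction_in_cone: "e \<in> cone"
  unfolding cone_def
proof (intro CollectI allI impI)
  fix l :: real assume "l \<ge> 0"
  then have "val (\<lambda>i. (1 + l) * e i) \<noteq> 0" using Fe unfolding val_scale by (simp add: val_def)
  then show "val (\<lambda>i. e i + l * e i) \<noteq> 0" by (simp add: distrib_right)
qed

lemma cone_root_negative:
  assumes a: "a \<in> cone" and z: "F (\<lambda>i. complex_of_real (a i) + \<kappa> * complex_of_real (e i)) = 0"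
  shows "Im \<kappa> = 0" "Re \<kappa> < 0"
proof -
  show "Im \<kappa> = 0" using z hyp' by blast
  then have "\<kappa> = of_real (Re \<kappa>)" by (simp add: complex_eq_iff)
  then have "val (\<lambda>i. a i + Re \<kappa> * e i) = 0"
    using z by (simp flip: val_eq_0_iff)
  then show "Re \<kappa> < 0" using a unfolding cone_def mem_Collect_eq not_le[symmetric] by blast
qed

text \<open>Deform \<open>z\<close> to \<open>0\<close>. On the way a real \<sigma> is no zero,
  because the point is then real plus a positive imaginary multiple of \<open>e\<close>. At the
  start, homogeneity turns a zero into a negative root \<kappa> of \<open>a\<close> along
  \<open>e\<close> with \<open>Im \<sigma> * Re \<kappa> = r\<close>, which contradicts
  \<open>Im \<sigma> \<ge> 0\<close>.\<close>

lemma nonzero_imaginary_direction: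
  assumes a: "a \<in> cone" and r: "r > 0" and \<sigma>: "Im \<sigma> \<ge> 0"
  shows "F (\<lambda>i. complex_of_real (z i) + \<i> * complex_of_real (r * e i) + \<sigma> * complex_of_real (a i)) \<noteq> 0"
proof (rule homogeneous_polyfun_homotopy[OF pf hom, where u = "\<lambda>i. \<i> * complex_of_real (r * e i)"])
  show "F (\<lambda>i. complex_of_real (a i)) \<noteq> 0" using cone_val_nonzero[OF a] val_eq_0_iff by blast
next
  fix s x :: real
  have "F (\<lambda>i. complex_of_real (s * z i + x * a i) + (\<i> * of_real r) * complex_of_real (e i)) \<noteq> 0"
    using r by (intro hyp) simp
  then show "F (\<lambda>i. (1 - complex_of_real s) * (\<i> * complex_of_real (r * e i)) +
      complex_of_real s * (complex_of_real (z i) + \<i> * complex_of_real (r * e i)) +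
      complex_of_real x * complex_of_real (a i)) \<noteq> 0"
    by (simp add: algebra_simps)
next
  fix \<sigma> assume \<sigma>: "Im \<sigma> \<ge> 0"
  show "F (\<lambda>i. \<i> * complex_of_real (r * e i) + \<sigma> * complex_of_real (a i)) \<noteq> 0"
  proof
    assume z: "F (\<lambda>i. \<i> * complex_of_real (r * e i) + \<sigma> * complex_of_real (a i)) = 0"
    show False
    proof (cases "\<sigma> = 0")
      case True
      then show False using z hom[of "\<i> * of_real r" "\<lambda>i. complex_of_real (e i)"] r Fe
        by (auto simp: mult.assoc)
    next
      case False
      define \<kappa> where "\<kappa> = \<i> * of_real r / \<sigma>"
      have "F (\<lambda>i. \<sigma> * (complex_of_real (a i) + \<kappa> * complex_of_real (e i))) = 0"
        using z False by (simp add: \<kappa>_def distrib_left add.commute mult.assoc)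
      then have "F (\<lambda>i. complex_of_real (a i) + \<kappa> * complex_of_real (e i)) = 0"
        unfolding hom using False by simp
      note \<kappa> = cone_root_negative[OF a this]
      have "\<kappa> = of_real (Re \<kappa>)" using \<kappa> by (simp add: complex_eq_iff)
      moreover have "\<sigma> * \<kappa> = \<i> * of_real r" using False by (simp add: \<kappa>_def)
      ultimately have "\<sigma> * of_real (Re \<kappa>) = \<i> * of_real r" by metis
      then have "Im (\<sigma> * of_real (Re \<kappa>)) = r" by simp
      then have "Im \<sigma> * Re \<kappa> = r" by simp
      then show False using r \<sigma> \<kappa>(2) mult_nonneg_nonpos[of "Im \<sigma>" "Re \<kappa>"] by linarith
    qed
  qed
qed (rule \<sigma>)

lemma cone_open_direction:
  assumes "a \<in> cone"
  obtains r where "r > 0" "(\<lambda>i. a i - r * e i) \<in> cone"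
proof -
  have "continuous_on UNIV (\<lambda>l. val (\<lambda>i. a i + l * e i))"
    by (intro continuous_on_val continuous_intros)
  then have "open ((\<lambda>l. val (\<lambda>i. a i + l * e i)) -` (- {0}))"
    by (intro open_vimage) auto
  moreover have "0 \<in> (\<lambda>l. val (\<lambda>i. a i + l * e i)) -` (- {0})"
    using cone_val_nonzero[OF assms] by simp
  ultimately obtain r where r: "r > 0" "cball 0 r \<subseteq> (\<lambda>l. val (\<lambda>i. a i + l * e i)) -` (- {0})"
    unfolding open_contains_cball by blast
  have "(\<lambda>i. a i - r * e i) \<in> cone"
    unfolding cone_def
  proof (intro CollectI allI impI)
    fix l :: real assume l: "l \<ge> 0"
    have "val (\<lambda>i. a i + (l - r) * e i) \<noteq> 0"
    proof (cases "l \<ge> r")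
      case True
      then show ?thesis using assms by (simp add: cone_def)
    next
      case False
      then have "l - r \<in> cball 0 r" using l by auto
      then show ?thesis using r(2) by auto
    qed
    then show "val (\<lambda>i. a i - r * e i + l * e i) \<noteq> 0" by (simp add: algebra_simps)
  qed
  then show thesis using that r by blast
qed

text \<open>Taking a small multiple \<open>r\<close> of \<open>e\<close> away from \<open>a\<close>
  stays in the cone and supplies the extra imaginary term of
  \<open>nonzero_imaginary_direction\<close>, used with \<sigma> = \<i>.\<close>

lemma hyperbolic_cone:
  assumes "a \<in> cone"
  shows "F (\<lambda>i. complex_of_real (z i) + \<i> * complex_of_real (a i)) \<noteq> 0"
proof -
  obtain r where r: "r > 0" "(\<lambda>i. a i - r * e i) \<in> cone"
    using cone_open_direction[OF assms] .
  show ?thesis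
    using nonzero_imaginary_direction[OF r(2,1), of \<i> z] by (simp add: algebra_simps)
qed

lemma cone_convex_direction:
  assumes "a \<in> cone" "0 \<le> s" "s \<le> 1"
  shows "(\<lambda>i. (1 - s) * e i + s * a i) \<in> cone"
proof (cases "s = 0")
  case True
  then show ?thesis using direction_in_cone by simp
next
  case False
  then show ?thesis
    using cone_add_direction[OF cone_scale[OF assms(1), of s], of "1 - s"] assms by (simp add: add.commute)
qed

text \<open>Garding's convexity theorem. Move the imaginary part from \<open>e\<close> to
  \<open>a\<close> inside the cone, looking at roots along \<open>b\<close>:
  \<open>hyperbolic_cone\<close> keeps them off the real axis. At \<sigma> = \<i> this makes
  \<open>val\<close> nonzero at the sum; adding multiples of \<open>e\<close> to \<open>b\<close>
  gives membership.\<close>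

lemma cone_add:
  assumes a: "a \<in> cone" and b: "b \<in> cone"
  shows "(\<lambda>i. a i + b i) \<in> cone"
proof -
  have "val (\<lambda>i. a i + b i) \<noteq> 0" if b: "b \<in> cone" for b
  proof -
    have "F (\<lambda>i. \<i> * complex_of_real (a i) + \<i> * complex_of_real (b i)) \<noteq> 0"
    proof (rule homogeneous_polyfun_homotopy[OF pf hom, where u = "\<lambda>i. \<i> * complex_of_real (e i)"])
      show "F (\<lambda>i. complex_of_real (b i)) \<noteq> 0" using cone_val_nonzero[OF b] val_eq_0_iff by blast
    next
      fix s x :: real assume "0 \<le> s" "s \<le> 1"
      then have "F (\<lambda>i. complex_of_real (x * b i) + \<i> * complex_of_real ((1 - s) * e i + s * a i)) \<noteq> 0"
        by (intro hyperbolic_cone cone_convex_direction a)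
      then show "F (\<lambda>i. (1 - complex_of_real s) * (\<i> * complex_of_real (e i)) +
          complex_of_real s * (\<i> * complex_of_real (a i)) + complex_of_real x * complex_of_real (b i)) \<noteq> 0"
        by (simp add: algebra_simps)
    next
      fix \<sigma> assume "Im \<sigma> \<ge> 0"
      then show "F (\<lambda>i. \<i> * complex_of_real (e i) + \<sigma> * complex_of_real (b i)) \<noteq> 0"
        using nonzero_imaginary_direction[OF b, of 1 \<sigma> "\<lambda>_. 0"] by simp
    qed simp
    then have "F (\<lambda>i. \<i> * complex_of_real (a i + b i)) \<noteq> 0" by (simp add: distrib_left)
    then show ?thesis unfolding hom by (simp add: val_eq_0_iff[symmetric])
  qed
  from this[OF cone_add_direction[OF b]] show ?thesis by (simp add: cone_def add.assoc)
qed

text \<open>A segment without zeros of \<open>val\<close> cannot leave the cone. The direction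
  \<open>r\<close> is \<open>e\<close> turned by \<open>- \<i>\<close>, so the closed upper half
  plane for \<sigma> becomes the half plane \<open>Re \<kappa> \<ge> 0\<close> for roots along
  \<open>e\<close>. Real \<sigma> is then covered by \<open>hyp'\<close>, except \<sigma> = 0, where
  \<open>nz\<close> applies.\<close>

lemma cone_segment:
  assumes a: "a \<in> cone"
    and nz: "\<And>s. 0 \<le> s \<Longrightarrow> s \<le> 1 \<Longrightarrow> val (\<lambda>i. (1 - s) * a i + s * b i) \<noteq> 0"
  shows "b \<in> cone"
  unfolding cone_def
proof (intro CollectI allI impI)
  fix l :: real assume l: "l \<ge> 0"
  define r where "r i = - \<i> * complex_of_real (e i)" for i
  have rot: "F r \<noteq> 0"
  proof -
    have "F r = (- \<i>) ^ D * F (\<lambda>i. complex_of_real (e i))"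
      unfolding r_def by (rule hom)
    moreover have "F (\<lambda>i. complex_of_real (e i)) \<noteq> 0" using Fe by auto
    ultimately show ?thesis by (metis complex_i_not_zero mult_eq_0_iff neg_equal_0_iff_equal power_not_zero)
  qed
  have "F (\<lambda>i. complex_of_real (b i) + (\<i> * of_real l) * r i) \<noteq> 0"
  proof (rule homogeneous_polyfun_homotopy[where F = F and D = D and b = r and u = "\<lambda>i. complex_of_real (a i)"
        and v = "\<lambda>i. complex_of_real (b i)" and \<sigma> = "\<i> * of_real l"])
    show "real_polyfun F" by (rule pf)
    show "F r \<noteq> 0" by (rule rot)
    show "F (\<lambda>i. c * w i) = c ^ D * F w" for c w by (rule hom)
  next
    fix s x :: real assume s: "0 \<le> s" "s \<le> 1"
    have "F (\<lambda>i. complex_of_real ((1 - s) * a i + s * b i) + (- \<i> * of_real x) * complex_of_real (e i)) \<noteq> 0"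
    proof (cases "x = 0")
      case True
      then show ?thesis using nz[OF s] val_eq_0_iff[of "\<lambda>i. (1 - s) * a i + s * b i"] by simp
    next
      case False
      then show ?thesis by (intro hyp') simp
    qed
    then show "F (\<lambda>i. (1 - complex_of_real s) * complex_of_real (a i) + complex_of_real s * complex_of_real (b i) +
        complex_of_real x * r i) \<noteq> 0"
      by (simp add: r_def algebra_simps)
  next
    fix \<sigma> assume \<sigma>: "Im \<sigma> \<ge> 0"
    show "F (\<lambda>i. complex_of_real (a i) + \<sigma> * r i) \<noteq> 0"
    proof
      assume "F (\<lambda>i. complex_of_real (a i) + \<sigma> * r i) = 0"
      then have "F (\<lambda>i. complex_of_real (a i) + (- \<i> * \<sigma>) * complex_of_real (e i)) = 0"
        by (simp add: r_def mult_ac)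
      from cone_root_negative[OF a this] \<sigma> show False by simp
    qed
  qed (use l in simp)
  moreover have "(\<lambda>i. complex_of_real (b i) + (\<i> * of_real l) * r i) = (\<lambda>i. complex_of_real (b i + l * e i))"
    by (auto simp: r_def fun_eq_iff complex_eq_iff)
  ultimately show "val (\<lambda>i. b i + l * e i) \<noteq> 0"
    using val_eq_0_iff by metis
qed

lemma cone_val_pos:
  assumes "a \<in> cone"
  shows "val a > 0"
proof (rule ccontr)
  assume "\<not> val a > 0"
  define f where "f s = val (\<lambda>i. (1 - s) * e i + s * a i)" for s
  have "continuous_on {0..1} f"
    unfolding f_def by (intro continuous_on_val continuous_intros)
  moreover have "f 1 \<le> 0" "f 0 \<ge> 0" using \<open>\<not> val a > 0\<close> Fe by (simp_all add: f_def) (simp add: val_def)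
  ultimately obtain s where "0 \<le> s" "s \<le> 1" "f s = 0"
    using IVT2'[of f 1 0 0] by auto
  then show False using cone_val_nonzero[OF cone_convex_direction[OF assms]] by (simp add: f_def)
qed

end

section \<open>The averaged polynomial of a strong Rayleigh measure\<close>

lemma real_polyfun_partition_fun: "real_polyfun (partition_fun n mu)"
  unfolding partition_fun_def
  by (intro real_polyfun_sum real_polyfun.mult real_polyfun.const real_polyfun_prod real_polyfun.coord)

lemma partition_fun_homogeneous:
  assumes "constant_sum n mu d"
  shows "partition_fun n mu (\<lambda>j. c * z j) = c ^ d * partition_fun n mu z"
  unfolding partition_fun_def sum_distrib_left
proof (intro sum.cong refl)
  fix S assume "S \<in> Pow {1..n}"
  then have "mu S = 0 \<or> card S = d" using assms by (auto simp: constant_sum_def)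
  then show "complex_of_real (mu S) * (\<Prod>j\<in>S. c * z j) = c ^ d * (complex_of_real (mu S) * (\<Prod>j\<in>S. z j))"
    by (auto simp: prod.distrib)
qed

text \<open>Affineness is written with the unit difference, which for an affine function is the
  partial derivative.\<close>

lemma partition_fun_affine:
  "partition_fun n mu (z(j := z j + c)) =
    partition_fun n mu z + c * (partition_fun n mu (z(j := z j + 1)) - partition_fun n mu z)"
proof -
  have mono: "(\<Prod>l\<in>S. (z(j := z j + c)) l) = (\<Prod>l\<in>S. z l) + c * ((\<Prod>l\<in>S. (z(j := z j + 1)) l) - (\<Prod>l\<in>S. z l))"
    if "finite S" for S
  proof (cases "j \<in> S")
    case True
    have "(\<Prod>l\<in>S. (z(j := x)) l) = x * (\<Prod>l\<in>S - {j}. z l)" for x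
      using that True by (subst prod.remove[of S j]) (auto intro!: prod.cong)
    from this[of "z j + c"] this[of "z j + 1"] this[of "z j"] show ?thesis
      by (simp add: algebra_simps)
  next
    case False
    then have "(\<Prod>l\<in>S. (z(j := x)) l) = (\<Prod>l\<in>S. z l)" for x
      by (intro prod.cong) auto
    then show ?thesis by simp
  qed
  have "complex_of_real (mu S) * (\<Prod>l\<in>S. (z(j := z j + c)) l) =
      complex_of_real (mu S) * (\<Prod>l\<in>S. z l) + c * (complex_of_real (mu S) * (\<Prod>l\<in>S. (z(j := z j + 1)) l)
        - complex_of_real (mu S) * (\<Prod>l\<in>S. z l))" if "S \<in> Pow {1..n}" for S
  proof -
    have "finite S" using that finite_subset[of S "{1..n}"] by auto
    then show ?thesis by (simp only: mono) (simp add: algebra_simps)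
  qed
  then show ?thesis
    unfolding partition_fun_def by (simp add: sum.distrib sum_subtractf sum_distrib_left right_diff_distrib)
qed

lemma partition_fun_cong:
  "(\<And>j. j \<in> {1..n} \<Longrightarrow> z j = z' j) \<Longrightarrow> partition_fun n mu z = partition_fun n mu z'"
  unfolding partition_fun_def by (intro sum.cong refl arg_cong2[of _ _ _ _ "(*)"] prod.cong) auto

lemma partition_fun_of_real:
  "partition_fun n mu (\<lambda>j. complex_of_real (x j)) = complex_of_real (partition_fun_real n mu x)"
  by (simp add: partition_fun_def partition_fun_real_def)

definition shift :: "'i \<Rightarrow> 'a \<Rightarrow> ('i \<Rightarrow> 'a :: ab_semigroup_add) \<Rightarrow> 'i \<Rightarrow> 'a" where
  "shift p c w = w(p := w p + c)"

lemma shift_commute: "shift p c (shift q c' w) = shift q c' (shift p c w)"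
  by (auto simp: shift_def fun_eq_iff ac_simps)

lemma shift_other: "q \<noteq> p \<Longrightarrow> shift p c w q = w q"
  by (simp add: shift_def)

lemma shift_0: "shift p (0 :: 'a :: comm_monoid_add) w = w"
  by (simp add: shift_def)

lemma Im_inverse_neg:
  fixes z :: complex
  assumes "Im z > 0"
  shows "Im (inverse z) < 0"
proof -
  have "(Re z)\<^sup>2 + (Im z)\<^sup>2 > 0" using assms by (intro add_nonneg_pos) auto
  then show ?thesis using assms by (simp add: divide_neg_pos)
qed

text \<open>The assumption \<open>key\<close> states \<open>1 / \<Psi> \<ge> \<theta> y + (1 - \<theta>) / \<Phi>\<close> in a form that makes sense for \<open>\<Phi> = 0\<close>.\<close>

lemma reciprocal_concave_bound:
  fixes \<Phi> \<Psi> y \<theta> :: real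
  assumes "\<Phi> \<ge> 0" "y > 0" "y * \<Phi> < 1" and \<theta>: "0 < \<theta>" "\<theta> < 1"
    and key: "\<And>y1. y1 \<ge> 0 \<Longrightarrow> y1 * \<Phi> < 1 \<Longrightarrow> (\<theta> * y + (1 - \<theta>) * y1) * \<Psi> < 1"
  shows "1 - y * \<Psi> \<ge> (1 - \<theta>) * (1 - y * \<Phi>)"
proof (cases "\<Psi> \<le> 0")
  case True
  then have "y * \<Psi> \<le> 0" using assms by (simp add: mult_nonneg_nonpos)
  moreover have "(1 - \<theta>) * (1 - y * \<Phi>) \<le> 1 * 1" using assms by (intro mult_mono) auto
  ultimately show ?thesis by simp
next
  case False
  have "\<Phi> > 0"
  proof (rule ccontr)
    assume "\<not> \<Phi> > 0"
    then have "\<Phi> = 0" using assms by simp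
    \<comment> \<open>For \<open>\<Phi> = 0\<close> every \<open>y1\<close> is admissible; this one
      already contributes 1 by itself.\<close>
    then have "(\<theta> * y + (1 - \<theta>) * (1 / ((1 - \<theta>) * \<Psi>))) * \<Psi> < 1"
      using False \<theta> by (intro key) auto
    then have "\<theta> * y * \<Psi> + 1 < 1" using False \<theta> by (simp add: distrib_right)
    moreover have "\<theta> * y * \<Psi> > 0" using False \<theta> assms by simp
    ultimately show False by simp
  qed
  define u where "u = y * \<Phi>"
  have u: "0 \<le> u" "u < 1" using assms by (auto simp: u_def)
  \<comment> \<open>The extreme \<open>y1 = 1 / \<Phi>\<close> just fails the strict condition in
    \<open>key\<close>, so it is approached by \<open>c / \<Phi>\<close> with
    \<open>c < 1\<close>.\<close>
  have "(\<theta> * u + (1 - \<theta>)) * (y * \<Psi>) \<le> u"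
  proof (rule field_le_mult_one_interval)
    fix c :: real assume c: "0 < c" "c < 1"
    have "(\<theta> * y + (1 - \<theta>) * (c / \<Phi>)) * \<Psi> < 1"
      using c \<open>\<Phi> > 0\<close> by (intro key) auto
    then have "(\<theta> * u + (1 - \<theta>) * c) * \<Psi> < \<Phi>"
      using \<open>\<Phi> > 0\<close> by (simp add: u_def field_simps)
    then have "(\<theta> * u + (1 - \<theta>) * c) * \<Psi> * y \<le> \<Phi> * y"
      using assms by (intro mult_right_mono) auto
    moreover have "c * (\<theta> * u + (1 - \<theta>)) * (\<Psi> * y) \<le> (\<theta> * u + (1 - \<theta>) * c) * (\<Psi> * y)"
    proof (rule mult_right_mono)
      have "c * (\<theta> * u) \<le> 1 * (\<theta> * u)" using c u \<theta> by (intro mult_right_mono) auto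
      then show "c * (\<theta> * u + (1 - \<theta>)) \<le> \<theta> * u + (1 - \<theta>) * c" by (simp add: algebra_simps)
    qed (use False assms in simp)
    ultimately show "c * ((\<theta> * u + (1 - \<theta>)) * (y * \<Psi>)) \<le> u"
      by (simp add: u_def mult_ac)
  qed
  also have "u \<le> (\<theta> * u + (1 - \<theta>)) * (1 - (1 - \<theta>) * (1 - u))"
  proof -
    have "(\<theta> * u + (1 - \<theta>)) * (1 - (1 - \<theta>) * (1 - u)) = u + (\<theta> * (1 - \<theta>)) * (1 - u)\<^sup>2"
      by (simp add: algebra_simps power2_eq_square)
    then show ?thesis using \<theta> by simp
  qed
  finally have "y * \<Psi> \<le> 1 - (1 - \<theta>) * (1 - u)"
    using u \<theta> by (subst (asm) mult_le_cancel_left_pos) (auto intro: add_nonneg_pos)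
  then show ?thesis by (simp add: u_def)
qed

locale rayleigh_copies =
  fixes n k d :: nat and mu :: "nat set \<Rightarrow> real"
  assumes k: "k \<ge> 1"
    and prob: "prob_measure_on n mu"
    and rayleigh: "strong_rayleigh n mu"
    and const_sum: "constant_sum n mu d"
begin

abbreviation "P \<equiv> partition_fun n mu"

text \<open>Coordinates \<open>(i, j)\<close> with \<open>1 \<le> i \<le> k\<close> are the variables of the \<open>i\<close>-th copy of \<open>P\<close>, coordinate
  \<open>(0, j)\<close> is a parameter \<open>y\<^sub>j\<close>. As \<open>P\<close> is affine in each variable, averaging the shifts by \<open>- k y\<^sub>j\<close> over the
  copies is the operator \<open>1 - y\<^sub>j (\<partial>\<^sub>1\<^sub>j + \<dots> + \<partial>\<^sub>k\<^sub>j)\<close>.\<close>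

primrec mixed :: "nat \<Rightarrow> (nat \<times> nat \<Rightarrow> complex) \<Rightarrow> complex" where
  "mixed 0 w = (\<Prod>i=1..k. P (\<lambda>j. w (i, j)))"
| "mixed (Suc m) w = (\<Sum>i=1..k. mixed m (shift (i, Suc m) (- of_nat k * w (0, Suc m)) w)) / of_nat k"

lemma real_polyfun_mixed: "real_polyfun (mixed m)"
proof (induction m)
  case 0
  have "real_polyfun (\<lambda>w. P (\<lambda>j. w (i, j)))" for i :: nat
    by (rule real_polyfun_subst[OF real_polyfun_partition_fun real_polyfun.coord])
  then show ?case unfolding mixed.simps by (intro real_polyfun_prod)
next
  case (Suc m)
  have "real_polyfun (\<lambda>w. shift (i, Suc m) (- of_nat k * w (0, Suc m)) w p)" for i p
  proof (cases "p = (i, Suc m)")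
    case True
    have "real_polyfun (\<lambda>w. w p + complex_of_real (- real k) * w (0, Suc m))"
      by (intro real_polyfun.intros)
    then show ?thesis using True by (simp add: shift_def)
  next
    case False
    then show ?thesis by (simp add: shift_def real_polyfun.coord)
  qed
  then have "real_polyfun (\<lambda>w. (\<Sum>i=1..k. mixed m (shift (i, Suc m) (- of_nat k * w (0, Suc m)) w))
      * complex_of_real (inverse (real k)))"
    by (intro real_polyfun.mult real_polyfun.const real_polyfun_sum real_polyfun_subst[OF Suc])
  then show ?case by (simp add: divide_inverse)
qed

lemma mixed_homogeneous: "mixed m (\<lambda>p. c * w p) = c ^ (k * d) * mixed m w"
proof (induction m arbitrary: w)
  case 0
  show ?case
    by (simp add: partition_fun_homogeneous[OF const_sum] prod.distrib power_mult mult.commute)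
next
  case (Suc m)
  have "shift (i, Suc m) (- of_nat k * (c * w (0, Suc m))) (\<lambda>p. c * w p) =
      (\<lambda>p. c * shift (i, Suc m) (- of_nat k * w (0, Suc m)) w p)" for i
    by (auto simp: shift_def fun_eq_iff algebra_simps)
  then show ?case by (simp add: Suc sum_distrib_left)
qed

lemma mixed_affine:
  assumes "i \<ge> 1"
  shows "mixed m (shift (i, j) c w) = mixed m w + c * (mixed m (shift (i, j) 1 w) - mixed m w)"
proof (induction m arbitrary: w)
  case 0
  have other: "P (\<lambda>l. shift (i, j) c w (i', l)) = P (\<lambda>l. w (i', l))" if "i' \<noteq> i" for i' c
    using that by (intro partition_fun_cong) (auto simp: shift_def)
  show ?case
  proof (cases "i \<in> {1..k}")
    case True
    define R where "R = (\<Prod>i'\<in>{1..k} - {i}. P (\<lambda>l. w (i', l)))"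
    define Q where "Q c = P ((\<lambda>l. w (i, l))(j := w (i, j) + c))" for c
    have "(\<lambda>l. shift (i, j) c w (i, l)) = (\<lambda>l. w (i, l))(j := w (i, j) + c)" for c
      by (auto simp: shift_def)
    then have "mixed 0 (shift (i, j) c w) = Q c * R" for c
      using True other unfolding mixed.simps Q_def R_def
      by (subst prod.remove[of _ i]) (auto intro!: prod.cong)
    moreover have "mixed 0 w = P (\<lambda>l. w (i, l)) * R"
      using True unfolding mixed.simps R_def by (subst prod.remove[of _ i]) auto
    moreover have "Q c = P (\<lambda>l. w (i, l)) + c * (Q 1 - P (\<lambda>l. w (i, l)))"
      using partition_fun_affine[of n mu "\<lambda>l. w (i, l)" j c] by (simp add: Q_def)
    ultimately show ?thesis
      by (simp only: left_diff_distrib right_diff_distrib distrib_right distrib_left mult.assoc)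
  next
    case False
    then have "mixed 0 (shift (i, j) c w) = mixed 0 w" for c
      unfolding mixed.simps by (intro prod.cong refl other) auto
    then show ?thesis by simp
  qed
next
  case (Suc m)
  define W where "W i' = shift (i', Suc m) (- of_nat k * w (0, Suc m)) w" for i'
  have "mixed (Suc m) (shift (i, j) c w) = (\<Sum>i'=1..k. mixed m (shift (i, j) c (W i'))) / of_nat k" for c
    using assms by (simp add: W_def shift_commute[of "(i, j)"] shift_other)
  moreover have "mixed (Suc m) w = (\<Sum>i'=1..k. mixed m (W i')) / of_nat k"
    by (simp add: W_def)
  moreover have "(\<Sum>i'=1..k. mixed m (shift (i, j) c (W i'))) = (\<Sum>i'=1..k. mixed m (W i')) +
      c * ((\<Sum>i'=1..k. mixed m (shift (i, j) 1 (W i'))) - (\<Sum>i'=1..k. mixed m (W i')))"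
  proof -
    have "mixed m (shift (i, j) c (W i')) =
        mixed m (W i') + c * (mixed m (shift (i, j) 1 (W i')) - mixed m (W i'))" for i'
      by (rule Suc)
    then show ?thesis
      by (simp only: sum.distrib sum_distrib_left[symmetric] sum_subtractf)
  qed
  ultimately show ?case
    by (simp only:) (simp add: add_divide_distrib diff_divide_distrib right_diff_distrib)
qed

lemma mixed_indep: "j > m \<Longrightarrow> mixed m (shift (0, j) y w) = mixed m w"
proof (induction m arbitrary: w)
  case 0
  have "P (\<lambda>l. shift (0, j) y w (i, l)) = P (\<lambda>l. w (i, l))" if "i \<in> {1..k}" for i
    using that by (intro partition_fun_cong) (auto simp: shift_def)
  then show ?case by simp
next
  case (Suc m)
  then show ?case by (simp add: shift_commute[of _ _ "(0, j)"] shift_other)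
qed

text \<open>The averaging operators commute, so raising a zero parameter acts as an outermost
  average even when later operators follow; the induction step swaps the two averages.\<close>

lemma mixed_parameter:
  assumes "1 \<le> j" "j \<le> m" "w (0, j) = 0"
  shows "mixed m (shift (0, j) y w) = (\<Sum>i=1..k. mixed m (shift (i, j) (- of_nat k * y) w)) / of_nat k"
  using assms
proof (induction m arbitrary: w)
  case 0
  then show ?case by linarith
next
  case (Suc m)
  show ?case
  proof (cases "j = Suc m")
    case True
    have "mixed (Suc m) w' = mixed m w'" if "w' (0, Suc m) = 0" for w'
      using that k by (simp add: shift_0)
    then have "mixed (Suc m) (shift (i, j) (- of_nat k * y) w) = mixed m (shift (i, j) (- of_nat k * y) w)"
      if "i \<in> {1..k}" for i
      using Suc.prems(3) True that by (auto simp del: mixed.simps simp: shift_other)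
    moreover have "mixed (Suc m) (shift (0, j) y w) = (\<Sum>i=1..k. mixed m (shift (i, j) (- of_nat k * y) w)) / of_nat k"
    proof -
      have "shift (0, j) y w (0, Suc m) = y" using True Suc.prems(3) by (simp add: shift_def)
      moreover have "mixed m (shift p c (shift (0, j) y w)) = mixed m (shift p c w)" for p c
        using True by (simp add: shift_commute[of p c] mixed_indep)
      ultimately show ?thesis using True by simp
    qed
    ultimately show ?thesis by (simp del: mixed.simps)
  next
    case False
    define W where "W i = shift (i, Suc m) (- of_nat k * w (0, Suc m)) w" for i
    have W0: "W i (0, j) = 0" if "i \<in> {1..k}" for i
      using that Suc.prems(3) by (simp add: W_def shift_other)
    have "mixed (Suc m) (shift (0, j) y w) = (\<Sum>i=1..k. mixed m (shift (0, j) y (W i))) / of_nat k"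
      using False by (simp add: W_def shift_commute[of _ _ "(0, j)"] shift_other)
    also have "\<dots> = (\<Sum>i=1..k. (\<Sum>i'=1..k. mixed m (shift (i', j) (- of_nat k * y) (W i))) / of_nat k) / of_nat k"
      using W0 Suc.prems False by (intro arg_cong2[of _ _ _ _ "(/)"] sum.cong refl Suc.IH) auto
    also have "\<dots> = (\<Sum>i'=1..k. (\<Sum>i=1..k. mixed m (shift (i', j) (- of_nat k * y) (W i))) / of_nat k) / of_nat k"
      unfolding sum_divide_distrib[symmetric] by (subst sum.swap) simp
    also have "\<dots> = (\<Sum>i'=1..k. mixed (Suc m) (shift (i', j) (- of_nat k * y) w)) / of_nat k"
    proof -
      have "mixed (Suc m) (shift (i', j) (- of_nat k * y) w) =
          (\<Sum>i=1..k. mixed m (shift (i', j) (- of_nat k * y) (W i))) / of_nat k" if "i' \<in> {1..k}" for i'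
        using that by (simp add: W_def shift_commute[of _ _ "(i', j)"] shift_other)
      then show ?thesis by simp
    qed
    finally show ?thesis .
  qed
qed

lemma mixed_eq_prod: "(\<And>j. j \<in> {1..m} \<Longrightarrow> w (0, j) = 0) \<Longrightarrow> mixed m w = (\<Prod>i=1..k. P (\<lambda>j. w (i, j)))"
proof (induction m)
  case (Suc m)
  then have "w (0, Suc m) = 0" "mixed m w = (\<Prod>i=1..k. P (\<lambda>j. w (i, j)))" by auto
  moreover have "shift (i, Suc m) (- of_nat k * w (0, Suc m)) w = w" for i
    using calculation(1) by (simp add: shift_def)
  ultimately show ?case using k unfolding mixed.simps(2) by simp
qed simp

text \<open>Each operator preserves stability. Since \<open>mixed m\<close> has no zero when one
  variable moves upwards, its logarithmic derivatives, and hence their sum \<open>S\<close>, vanish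
  or lie in the lower half plane. The next polynomial is \<open>mixed m w * (1 - y * S)\<close>, and
  \<open>y * S = 1\<close> would force \<open>Im y > 0\<close>.\<close>

lemma mixed_nonzero:
  assumes "\<And>i j. i \<in> {1..k} \<Longrightarrow> j \<in> {1..n} \<Longrightarrow> Im (w (i, j)) > 0"
    and "\<And>j. j \<in> {1..n} \<Longrightarrow> Im (w (0, j)) \<le> 0" and "m \<le> n"
  shows "mixed m w \<noteq> 0"
  using assms
proof (induction m arbitrary: w)
  case 0
  have "P (\<lambda>j. w (i, j)) \<noteq> 0" if "i \<in> {1..k}" for i
    using rayleigh 0(1)[OF that] unfolding strong_rayleigh_def by simp
  then show ?case by simp
next
  case (Suc m)
  define y where "y = w (0, Suc m)"
  define B where "B i = mixed m (shift (i, Suc m) 1 w) - mixed m w" for i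
  define S where "S = (\<Sum>i=1..k. B i / mixed m w)"
  have y: "Im y \<le> 0" unfolding y_def using Suc.prems by auto
  have nz: "mixed m w \<noteq> 0" by (rule Suc.IH) (use Suc.prems in auto)
  have aff: "mixed m (shift (i, Suc m) c w) = mixed m w + c * B i" if "i \<in> {1..k}" for i c
    unfolding B_def by (rule mixed_affine) (use that in simp)
  have B: "B i = 0 \<or> Im (B i / mixed m w) < 0" if i: "i \<in> {1..k}" for i
  proof (cases "B i = 0")
    case False
    \<comment> \<open>The quotient is the zero of the affine function
      \<open>c \<mapsto> mixed m w + c * B i\<close>; a shift by it with nonnegative imaginary part
      would stay in the zero-free region.\<close>
    have "\<not> Im (- mixed m w / B i) \<ge> 0"
    proof
      assume *: "Im (- mixed m w / B i) \<ge> 0"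
      have "mixed m (shift (i, Suc m) (- mixed m w / B i) w) \<noteq> 0"
      proof (rule Suc.IH)
        fix i' j assume "i' \<in> {1..k}" "j \<in> {1..n}"
        then show "0 < Im (shift (i, Suc m) (- mixed m w / B i) w (i', j))"
          using Suc.prems(1)[of i' j] * by (auto simp: shift_def)
      next
        fix j assume "j \<in> {1..n}"
        then show "Im (shift (i, Suc m) (- mixed m w / B i) w (0, j)) \<le> 0"
          using Suc.prems(2) i by (auto simp: shift_def)
      qed (use Suc.prems in auto)
      then show False using aff[OF i] False by simp
    qed
    then have "Im (mixed m w / B i) > 0" by simp
    from Im_inverse_neg[OF this] show ?thesis by simp
  qed simp
  have S: "S = 0 \<or> Im S < 0"
  proof (cases "\<forall>i\<in>{1..k}. B i = 0")
    case False
    then obtain i where i: "i \<in> {1..k}" "B i \<noteq> 0" by blast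
    have "Im (B i' / mixed m w) \<le> 0" if "i' \<in> {1..k}" for i'
      using B[OF that] by auto
    moreover have "Im (B i / mixed m w) < 0" using B i by blast
    ultimately have "(\<Sum>i=1..k. Im (B i / mixed m w)) < (\<Sum>i=1..k. 0)"
      using i(1) by (intro sum_strict_mono_ex1) (blast | simp)+
    then show ?thesis by (simp add: S_def)
  qed (simp add: S_def)
  have "mixed (Suc m) w = (\<Sum>i=1..k. mixed m w - of_nat k * y * B i) / of_nat k"
    by (simp add: aff y_def[symmetric])
  also have "\<dots> = mixed m w * (1 - y * S)"
  proof -
    have "(\<Sum>i=1..k. B i) = S * mixed m w"
      using nz by (simp add: S_def sum_divide_distrib[symmetric])
    then have "(\<Sum>i=1..k. mixed m w - of_nat k * y * B i) = of_nat k * (mixed m w * (1 - y * S))"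
      by (simp only: sum_subtractf sum_distrib_left[symmetric]) (simp add: algebra_simps)
    then show ?thesis using k by simp
  qed
  finally have eq: "mixed (Suc m) w = mixed m w * (1 - y * S)" .
  have "y * S \<noteq> 1"
  proof
    assume "y * S = 1"
    from inverse_unique[OF this] this have "inverse y = S" "S \<noteq> 0" by auto
    then have "Im (inverse (- y)) > 0" using S by auto
    from Im_inverse_neg[OF this] have "Im y > 0" by simp
    then show False using y by simp
  qed
  then show ?case using eq nz by simp
qed

section \<open>Hyperbolicity in variables and parameters jointly\<close>

definition ones :: "nat \<times> nat \<Rightarrow> real" where
  "ones p = (if fst p \<in> {1..k} \<and> snd p \<in> {1..n} then 1 else 0)"

definition var_dir :: "nat \<Rightarrow> nat \<times> nat \<Rightarrow> real" where
  "var_dir j p = (if fst p \<in> {1..k} \<and> snd p = j then 1 else 0)"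

definition par_dir :: "nat \<Rightarrow> nat \<times> nat \<Rightarrow> real" where
  "par_dir j p = (if p = (0, j) then 1 else 0)"

lemma par_dir_simps [simp]: "par_dir j (0, i) = (if i = j then 1 else 0)" "i \<noteq> 0 \<Longrightarrow> par_dir j (i, l) = 0"
  by (auto simp: par_dir_def)

lemma var_dir_simps [simp]: "var_dir j (0, i) = 0" "i \<in> {1..k} \<Longrightarrow> var_dir j (i, l) = (if l = j then 1 else 0)"
  by (auto simp: var_dir_def)

lemma ones_simps [simp]: "ones (0, i) = 0" "i \<in> {1..k} \<Longrightarrow> ones (i, l) = (if l \<in> {1..n} then 1 else 0)"
  by (auto simp: ones_def)

lemma partition_fun_ones: "P (\<lambda>j. if j \<in> {1..n} then 1 else 0) = 1"
proof -
  have "P (\<lambda>j. if j \<in> {1..n} then 1 else 0) = P (\<lambda>j. complex_of_real 1)"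
    by (rule partition_fun_cong) simp
  also have "\<dots> = 1"
    unfolding partition_fun_of_real using prob by (simp add: partition_fun_real_def prob_measure_on_def)
  finally show ?thesis .
qed

sublocale hyperbolic_polyfun "mixed n" "k * d" ones
proof
  show "real_polyfun (mixed n)" by (rule real_polyfun_mixed)
  show "mixed n (\<lambda>i. c * w i) = c ^ (k * d) * mixed n w" for c w by (rule mixed_homogeneous)
  show "mixed n (\<lambda>i. complex_of_real (z i) + \<sigma> * complex_of_real (ones i)) \<noteq> 0" if "Im \<sigma> > 0" for \<sigma> z
    by (rule mixed_nonzero) (use that in auto)
  have "mixed n (\<lambda>i. complex_of_real (ones i)) = (\<Prod>i=1..k. P (\<lambda>j. complex_of_real (ones (i, j))))"
    by (rule mixed_eq_prod) simp
  also have "\<dots> = 1"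
  proof (rule prod.neutral, rule ballI)
    fix i assume "i \<in> {1..k}"
    then have "P (\<lambda>j. complex_of_real (ones (i, j))) = P (\<lambda>j. if j \<in> {1..n} then 1 else 0)"
      by (intro partition_fun_cong) simp
    then show "P (\<lambda>j. complex_of_real (ones (i, j))) = 1" unfolding partition_fun_ones .
  qed
  finally show "Re (mixed n (\<lambda>i. complex_of_real (ones i))) > 0" by simp
qed

text \<open>Multiplication by \<i> moves the variables to the upper and the parameters to the closed
  lower half plane, where \<open>mixed_nonzero\<close> applies; homogeneity removes the
  factor.\<close>

lemma positive_in_cone:
  assumes "\<And>i j. i \<in> {1..k} \<Longrightarrow> j \<in> {1..n} \<Longrightarrow> v (i, j) > 0"
    and "\<And>j. j \<in> {1..n} \<Longrightarrow> v (0, j) \<le> 0"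
  shows "v \<in> cone"
  unfolding cone_def
proof (intro CollectI allI impI)
  fix l :: real assume l: "l \<ge> 0"
  have "mixed n (\<lambda>p. \<i> * complex_of_real (v p + l * ones p)) \<noteq> 0"
    by (rule mixed_nonzero) (use assms l in \<open>auto intro: add_pos_nonneg\<close>)
  then have "mixed n (\<lambda>p. complex_of_real (v p + l * ones p)) \<noteq> 0"
    unfolding mixed_homogeneous by simp
  then show "val (\<lambda>p. v p + l * ones p) \<noteq> 0" unfolding val_eq_0_iff .
qed

text \<open>Slack \<open>r\<close> borrowed from \<open>a\<close> makes \<open>v\<close> strictly
  positive in the variables; convexity of the cone adds the parts.\<close>

lemma cone_add_nonneg:
  assumes a: "a \<in> cone"
    and "\<And>i j. i \<in> {1..k} \<Longrightarrow> j \<in> {1..n} \<Longrightarrow> v (i, j) \<ge> 0"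
    and "\<And>j. j \<in> {1..n} \<Longrightarrow> v (0, j) \<le> 0"
  shows "(\<lambda>p. a p + v p) \<in> cone"
proof -
  obtain r where r: "r > 0" "(\<lambda>p. a p - r * ones p) \<in> cone"
    using cone_open_direction[OF a] .
  have "(\<lambda>p. v p + r * ones p) \<in> cone"
    by (rule positive_in_cone) (use assms r in \<open>auto intro: add_nonneg_pos\<close>)
  from cone_add[OF r(2) this] show ?thesis by simp
qed

lemma val_parameter_average:
  assumes "j \<in> {1..n}" "a (0, j) = 0"
  shows "val (\<lambda>p. a p + y * par_dir j p) = (\<Sum>i=1..k. val (shift (i, j) (- real k * y) a)) / real k"
proof -
  have "(\<lambda>p. complex_of_real (a p + y * par_dir j p)) = shift (0, j) (of_real y) (\<lambda>p. of_real (a p))"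
    by (auto simp: shift_def par_dir_def fun_eq_iff)
  moreover have "shift (i, j) (- of_nat k * complex_of_real y) (\<lambda>p. of_real (a p)) =
      (\<lambda>p. of_real (shift (i, j) (- real k * y) a p))" for i
    by (auto simp: shift_def fun_eq_iff)
  ultimately have "mixed n (\<lambda>p. complex_of_real (a p + y * par_dir j p)) =
      (\<Sum>i=1..k. mixed n (\<lambda>p. of_real (shift (i, j) (- real k * y) a p))) / of_nat k"
    using mixed_parameter[of j n "\<lambda>p. of_real (a p)" "of_real y"] assms by simp
  also have "\<dots> = of_real ((\<Sum>i=1..k. val (shift (i, j) (- real k * y) a)) / real k)"
    by (simp only: of_real_val of_real_sum[symmetric] of_real_divide of_real_of_nat_eq)
  finally show ?thesis unfolding of_real_val of_real_eq_iff .
qed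

lemma val_affine:
  assumes "i \<in> {1..k}"
  shows "val (shift (i, j) c a) = val a + c * (val (shift (i, j) 1 a) - val a)"
proof -
  have *: "mixed n (shift (i, j) (of_real c) (\<lambda>p. of_real (a p))) = of_real (val (shift (i, j) c a))" for c
  proof -
    have "shift (i, j) (of_real c) (\<lambda>p. of_real (a p)) = (\<lambda>p. complex_of_real (shift (i, j) c a p))"
      by (auto simp: shift_def fun_eq_iff)
    then show ?thesis by (simp add: of_real_val)
  qed
  have "complex_of_real (val (shift (i, j) c a)) =
      of_real (val a) + of_real c * (of_real (val (shift (i, j) 1 a)) - of_real (val a))"
    using mixed_affine[of i n j "of_real c" "\<lambda>p. of_real (a p)"] assms
    unfolding * *[of 1, unfolded of_real_1] of_real_val by simp
  then show ?thesis
    by (simp only: of_real_add[symmetric] of_real_mult[symmetric] of_real_diff[symmetric] of_real_eq_iff)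
qed

text \<open>This is the sum over the copies of the derivatives in variable \<open>j\<close>: by
  affineness each unit difference is a partial derivative.\<close>

definition slope :: "nat \<Rightarrow> (nat \<times> nat \<Rightarrow> real) \<Rightarrow> real" where
  "slope j a = (\<Sum>i=1..k. val (shift (i, j) 1 a) - val a)"

lemma val_parameter:
  assumes "j \<in> {1..n}" "a (0, j) = 0"
  shows "val (\<lambda>p. a p + y * par_dir j p) = val a - y * slope j a"
proof -
  have "(\<Sum>i=1..k. val (shift (i, j) (- real k * y) a)) =
      (\<Sum>i=1..k. val a - real k * y * (val (shift (i, j) 1 a) - val a))"
    by (intro sum.cong refl, subst val_affine) auto
  also have "\<dots> = real k * (val a - y * slope j a)"
    by (simp add: sum_subtractf sum_distrib_left[symmetric] slope_def algebra_simps)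
  finally show ?thesis using val_parameter_average[of j a y] assms k by simp
qed

text \<open>The direction is a sum of \<open>k\<close> unit vectors, along each of which the
  polynomial is exactly affine; the differential adds their unit differences.\<close>

lemma has_derivative_val_direction:
  "((\<lambda>r. val (\<lambda>p. a p + r * var_dir j p)) has_real_derivative slope j (\<lambda>p. a p + r0 * var_dir j p)) (at r0)"
proof -
  obtain G where G: "\<And>w v. ((\<lambda>r::real. mixed n (\<lambda>i. w i + of_real r * v i)) has_vector_derivative G w v) (at 0)"
    and add: "\<And>w u v. G w (\<lambda>i. u i + v i) = G w u + G w v"
    by (rule real_polyfun_differential[OF real_polyfun_mixed[of n], of thesis]) (rule that)
  define w where "w p = complex_of_real (a p + r0 * var_dir j p)" for p
  have zero: "G w (\<lambda>_. 0) = 0" using add[of w "\<lambda>_. 0" "\<lambda>_. 0"] by simp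
  have sum: "G w (\<lambda>p. \<Sum>i\<in>I. f i p) = (\<Sum>i\<in>I. G w (f i))" if "finite I" for I :: "nat set" and f
    using that by induction (simp_all add: zero add)
  have single: "G w (\<lambda>p. if p = (i, j) then 1 else 0) = mixed n (shift (i, j) 1 w) - mixed n w"
    if "i \<in> {1..k}" for i
  proof (rule vector_derivative_unique_at[OF G])
    have "(\<lambda>p. w p + complex_of_real r * (if p = (i, j) then 1 else 0)) = shift (i, j) (of_real r) w" for r
      by (auto simp: shift_def fun_eq_iff)
    then have eq: "mixed n (\<lambda>p. w p + complex_of_real r * (if p = (i, j) then 1 else 0)) =
        mixed n w + of_real r * (mixed n (shift (i, j) 1 w) - mixed n w)" for r
      using mixed_affine[of i n j "of_real r" w] that by simp
    show "((\<lambda>r. mixed n (\<lambda>p. w p + complex_of_real r * (if p = (i, j) then 1 else 0)))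
        has_vector_derivative mixed n (shift (i, j) 1 w) - mixed n w) (at 0)"
      unfolding eq by (auto intro!: derivative_eq_intros has_vector_derivative_of_real)
  qed
  have dir: "(\<lambda>p. complex_of_real (var_dir j p)) = (\<lambda>p. \<Sum>i\<in>{1..k}. if p = (i, j) then 1 else 0)"
  proof
    fix p :: "nat \<times> nat"
    obtain i l where "p = (i, l)" by (cases p)
    then show "complex_of_real (var_dir j p) = (\<Sum>i\<in>{1..k}. if p = (i, j) then 1 else 0)"
      by (auto simp: var_dir_def)
  qed
  have "G w (\<lambda>p. complex_of_real (var_dir j p)) = (\<Sum>i=1..k. mixed n (shift (i, j) 1 w) - mixed n w)"
    unfolding dir sum[OF finite_atLeastAtMost] by (intro sum.cong refl single)
  also have "\<dots> = of_real (slope j (\<lambda>p. a p + r0 * var_dir j p))"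
  proof -
    have "shift (i, j) 1 w = (\<lambda>p. complex_of_real (shift (i, j) 1 (\<lambda>p. a p + r0 * var_dir j p) p))" for i
      by (auto simp: shift_def w_def fun_eq_iff)
    moreover have "mixed n w = complex_of_real (val (\<lambda>p. a p + r0 * var_dir j p))"
      by (simp only: w_def[abs_def] of_real_val)
    ultimately show ?thesis unfolding slope_def by (simp only: of_real_val of_real_diff of_real_sum)
  qed
  finally have "((\<lambda>r::real. mixed n (\<lambda>p. w p + of_real r * of_real (var_dir j p))) has_vector_derivative
      of_real (slope j (\<lambda>p. a p + r0 * var_dir j p))) (at 0)"
    using G[of w "\<lambda>p. of_real (var_dir j p)"] by simp
  then have "((\<lambda>r::real. Re (mixed n (\<lambda>p. w p + of_real r * of_real (var_dir j p)))) has_vector_derivative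
      slope j (\<lambda>p. a p + r0 * var_dir j p)) (at 0)"
    using bounded_linear.has_vector_derivative[OF bounded_linear_Re] by fastforce
  moreover have "Re (mixed n (\<lambda>p. w p + of_real r * of_real (var_dir j p))) =
      val (\<lambda>p. a p + (r + r0) * var_dir j p)" for r
    by (simp add: val_def w_def algebra_simps)
  ultimately have "((\<lambda>r. val (\<lambda>p. a p + (r + r0) * var_dir j p)) has_real_derivative
      slope j (\<lambda>p. a p + r0 * var_dir j p)) (at 0)"
    by (simp add: has_real_derivative_iff_has_vector_derivative)
  then show ?thesis using DERIV_shift[of "\<lambda>r. val (\<lambda>p. a p + r * var_dir j p)" _ 0 r0] by simp
qed

subsection \<open>The barrier argument\<close>

lemma cone_add_var_dir:
  assumes "a \<in> cone" "r \<ge> 0"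
  shows "(\<lambda>p. a p + r * var_dir j p) \<in> cone"
  using assms by (intro cone_add_nonneg) auto

lemma cone_sub_par_dir:
  assumes "a \<in> cone" "r \<ge> 0"
  shows "(\<lambda>p. a p - r * par_dir j p) \<in> cone"
proof -
  have "(\<lambda>p. a p + (- r * par_dir j p)) \<in> cone"
    by (rule cone_add_nonneg[OF assms(1)]) (use assms in auto)
  then show ?thesis by simp
qed

text \<open>\<open>val\<close> is affine along a parameter ray, so a positive value at its end
  excludes zeros on the segment. For \<open>y > 0\<close>, membership thus encodes the barrier bound
  \<open>slope j a / val a < 1 / y\<close>.\<close>

lemma cone_par_dir_iff:
  assumes j: "j \<in> {1..n}" "a (0, j) = 0" and a: "a \<in> cone" and y: "y \<ge> 0"
  shows "(\<lambda>p. a p + y * par_dir j p) \<in> cone \<longleftrightarrow> y * slope j a < val a"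
proof
  assume "(\<lambda>p. a p + y * par_dir j p) \<in> cone"
  from cone_val_pos[OF this] show "y * slope j a < val a"
    unfolding val_parameter[of j a, OF j] by simp
next
  assume less: "y * slope j a < val a"
  show "(\<lambda>p. a p + y * par_dir j p) \<in> cone"
  proof (rule cone_segment[OF a])
    fix s :: real assume s: "0 \<le> s" "s \<le> 1"
    have "s * (y * slope j a) < val a"
    proof (cases "slope j a \<ge> 0")
      case True
      then have "s * (y * slope j a) \<le> 1 * (y * slope j a)"
        using s y by (intro mult_right_mono) auto
      then show ?thesis using less by simp
    next
      case False
      then have "s * (y * slope j a) \<le> 0" using s y by (simp add: mult_nonneg_nonpos)
      then show ?thesis using cone_val_pos[OF a] by simp
    qed
    moreover have "(\<lambda>p. (1 - s) * a p + s * (a p + y * par_dir j p)) = (\<lambda>p. a p + (s * y) * par_dir j p)"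
      by (auto simp: algebra_simps)
    ultimately show "val (\<lambda>p. (1 - s) * a p + s * (a p + y * par_dir j p)) \<noteq> 0"
      using val_parameter[of j a, OF j, of "s * y"] by simp
  qed
qed

text \<open>Otherwise lowering parameter \<open>j\<close>, which stays in the cone, would reach a
  zero of \<open>val\<close> at distance \<open>r\<close>.\<close>

lemma slope_nonneg:
  assumes "j \<in> {1..n}" "a (0, j) = 0" "a \<in> cone"
  shows "slope j a \<ge> 0"
proof (rule ccontr)
  assume neg: "\<not> slope j a \<ge> 0"
  define r where "r = - val a / slope j a"
  have "r \<ge> 0" using neg cone_val_pos[OF assms(3)] by (simp add: r_def divide_nonneg_neg)
  from cone_val_pos[OF cone_sub_par_dir[OF assms(3) this, of j]]
  have "val a + r * slope j a > 0" using val_parameter[of j a "- r"] assms by simp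
  then show False using neg by (simp add: r_def)
qed

text \<open>\<open>R / A\<close> is 1 minus \<open>y\<close> times the barrier of \<open>i\<close>.
  Convexity of the cone combines the start, with parameter \<open>y\<close>, and the point at
  \<open>s\<close>, with any admissible \<open>y1\<close>; this is \<open>key\<close> of
  \<open>reciprocal_concave_bound\<close>. The result is concavity of the quotient with its positive
  value at the start dropped.\<close>

lemma barrier_concave:
  assumes i: "i \<in> {1..n}" "a (0, i) = 0" and j: "j \<in> {1..n}"
    and s: "s > 0" and y: "y > 0"
    and start: "(\<lambda>p. a p + y * par_dir i p) \<in> cone"
    and \<theta>: "0 < \<theta>" "\<theta> < 1"
  defines "A \<equiv> \<lambda>r. val (\<lambda>p. a p + r * var_dir j p)"
    and "R \<equiv> \<lambda>r. val (\<lambda>p. (a p + y * par_dir i p) + r * var_dir j p)"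
  shows "R (s - \<theta> * s) / A (s - \<theta> * s) \<ge> (1 - \<theta>) * (R s / A s)"
proof -
  define x where "x r p = a p + r * var_dir j p" for r p
  have a: "a \<in> cone" using cone_sub_par_dir[OF start, of y i] y by simp
  have x0: "x r (0, i) = 0" for r using i by (simp add: x_def)
  have xc: "x r \<in> cone" if "r \<ge> 0" for r
    unfolding x_def[abs_def] using cone_add_var_dir[OF a that] .
  have Aeq: "A r = val (x r)" for r by (simp add: A_def x_def[abs_def])
  have Req: "R r = val (x r) - y * slope i (x r)" for r
    using val_parameter[of i "x r" y, OF i(1) x0] by (simp add: R_def x_def algebra_simps)
  define z where "z = x (s - \<theta> * s)"
  have pos: "val (x s) > 0" "val z > 0"
    using xc cone_val_pos s \<theta> by (auto simp: z_def)
  have key: "(\<theta> * y + (1 - \<theta>) * y1) * slope i z < val z"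
    if y1: "y1 \<ge> 0" "y1 * slope i (x s) < val (x s)" for y1
  proof -
    have "(\<lambda>p. x s p + y1 * par_dir i p) \<in> cone"
      using cone_par_dir_iff[of i "x s" y1, OF i(1) x0 xc y1(1)] y1 s by auto
    from cone_scale[OF this, of "1 - \<theta>"] have "(\<lambda>p. (1 - \<theta>) * (x s p + y1 * par_dir i p)) \<in> cone"
      using \<theta> by simp
    from cone_add[OF this cone_scale[OF start \<theta>(1)]]
    have "(\<lambda>p. (1 - \<theta>) * (x s p + y1 * par_dir i p) + \<theta> * (a p + y * par_dir i p)) \<in> cone" .
    also have "(\<lambda>p. (1 - \<theta>) * (x s p + y1 * par_dir i p) + \<theta> * (a p + y * par_dir i p)) =
        (\<lambda>p. z p + (\<theta> * y + (1 - \<theta>) * y1) * par_dir i p)"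
      by (auto simp: z_def x_def algebra_simps)
    finally show ?thesis
      using cone_par_dir_iff[of i z] i x0 xc s \<theta> y y1 by (simp add: z_def)
  qed
  have "R s / A s = 1 - y * (slope i (x s) / val (x s))" "R (s - \<theta> * s) / A (s - \<theta> * s) = 1 - y * (slope i z / val z)"
    using pos by (simp_all add: Aeq Req z_def diff_divide_distrib)
  moreover have "1 - y * (slope i z / val z) \<ge> (1 - \<theta>) * (1 - y * (slope i (x s) / val (x s)))"
  proof (rule reciprocal_concave_bound[OF _ y _ \<theta>])
    show "slope i (x s) / val (x s) \<ge> 0"
      using slope_nonneg[of i "x s", OF i(1) x0 xc] s pos by simp
    have "(\<lambda>p. x s p + y * par_dir i p) \<in> cone"
      using cone_add_var_dir[OF start, of s j] s by (simp add: x_def algebra_simps)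
    then show "y * (slope i (x s) / val (x s)) < 1"
      using cone_par_dir_iff[of i "x s" y, OF i(1) x0 xc] s y pos by (simp add: field_simps)
    show "(\<theta> * y + (1 - \<theta>) * y1) * (slope i z / val z) < 1"
      if "y1 \<ge> 0" "y1 * (slope i (x s) / val (x s)) < 1" for y1
      using key[of y1] that pos by (simp add: divide_less_eq)
  qed
  ultimately show ?thesis by simp
qed

text \<open>The hypothesis \<open>aj\<close> persists along the shift and gives
  \<open>A' / A s < 1 - 1 / s\<close>; concavity of the quotient gives
  \<open>R' / R s \<le> A' / A s + 1 / s\<close>. Together \<open>R' < R s\<close>, so after the
  shift parameter \<open>j\<close> can rise to 1 while parameter \<open>i\<close> keeps the value
  \<open>y\<close>.\<close>

lemma barrier_step:
  assumes i: "i \<in> {1..n}" "a (0, i) = 0" and j: "j \<in> {1..n}" "a (0, j) = 0" and "i \<noteq> j"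
    and s: "s > 1" and y: "y > 0"
    and ai: "(\<lambda>p. a p + y * par_dir i p) \<in> cone"
    and aj: "(\<lambda>p. a p + s / (s - 1) * par_dir j p) \<in> cone"
  shows "(\<lambda>p. a p + (s * var_dir j p + par_dir j p) + y * par_dir i p) \<in> cone"
proof -
  define b where "b p = a p + y * par_dir i p" for p
  define A where "A r = val (\<lambda>p. a p + r * var_dir j p)" for r
  define R where "R r = val (\<lambda>p. b p + r * var_dir j p)" for r
  define A' where "A' = slope j (\<lambda>p. a p + s * var_dir j p)"
  define R' where "R' = slope j (\<lambda>p. b p + s * var_dir j p)"
  have dA: "(A has_real_derivative A') (at s)" and dR: "(R has_real_derivative R') (at s)"
    unfolding A_def[abs_def] A'_def R_def[abs_def] R'_def by (rule has_derivative_val_direction)+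
  have ca: "(\<lambda>p. a p + s * var_dir j p) \<in> cone"
    using cone_add_var_dir[OF cone_sub_par_dir[OF ai, of y i], of s j] s y by simp
  have cb: "(\<lambda>p. b p + s * var_dir j p) \<in> cone"
    using cone_add_var_dir[OF ai, of s j] s by (simp add: b_def)
  have pos: "A s > 0" "R s > 0"
    using cone_val_pos[OF ca] cone_val_pos[OF cb] by (auto simp: A_def R_def)
  have "(\<lambda>p. a p + s * var_dir j p + s / (s - 1) * par_dir j p) \<in> cone"
    using cone_add_var_dir[OF aj, of s j] s by (simp add: add_ac)
  then have "s / (s - 1) * A' < A s"
    using cone_par_dir_iff[of j "\<lambda>p. a p + s * var_dir j p" "s / (s - 1)"] ca j s
    by (simp add: A_def A'_def)
  then have A': "A' < A s * (1 - 1 / s)"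
    using s by (simp add: field_simps)
  \<comment> \<open>The quotient minus its chord through the origin: it vanishes at \<open>s\<close>
    and is nonnegative to the left of it, so its derivative at \<open>s\<close> is not
    positive.\<close>
  define \<phi> where "\<phi> r = R r / A r - r / s * (R s / A s)" for r
  have "(\<phi> has_real_derivative (R' * A s - R s * A') / (A s * A s) - 1 / s * (R s / A s)) (at s)"
    unfolding \<phi>_def using pos s by (auto intro!: derivative_eq_intros dA dR)
  moreover have "\<not> (R' * A s - R s * A') / (A s * A s) - 1 / s * (R s / A s) > 0"
  proof
    assume "(R' * A s - R s * A') / (A s * A s) - 1 / s * (R s / A s) > 0"
    from DERIV_pos_inc_left[OF calculation this]
    obtain \<delta> where \<delta>: "\<delta> > 0" "\<And>h. h > 0 \<Longrightarrow> h < \<delta> \<Longrightarrow> \<phi> (s - h) < \<phi> s" by blast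
    define \<theta> where "\<theta> = min (1 / 2) (\<delta> / (2 * s))"
    have \<theta>: "0 < \<theta>" "\<theta> < 1" using \<delta> s by (auto simp: \<theta>_def)
    have "\<theta> * s \<le> \<delta> / (2 * s) * s" using s by (intro mult_right_mono) (auto simp: \<theta>_def)
    then have "\<theta> * s < \<delta>" using s \<delta>(1) by simp
    then have "\<phi> (s - \<theta> * s) < \<phi> s" using \<theta> s by (intro \<delta>) auto
    moreover have "R (s - \<theta> * s) / A (s - \<theta> * s) \<ge> (1 - \<theta>) * (R s / A s)"
      using barrier_concave[OF i j(1) _ y ai \<theta>, of s] s by (simp add: A_def R_def b_def)
    moreover have "(s - \<theta> * s) / s = 1 - \<theta>" "s / s = 1" using s by (simp_all add: field_simps)
    ultimately show False by (simp add: \<phi>_def)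
  qed
  ultimately have "(R' * A s - R s * A') / (A s * A s) \<le> 1 / s * (R s / A s)" by simp
  then have "R' * A s - R s * A' \<le> 1 / s * (R s / A s) * (A s * A s)"
    using pos by (simp add: pos_divide_le_eq)
  then have "R' * A s - R s * A' \<le> R s * (A s / s)"
    using pos by simp
  moreover have "R s * A' < R s * (A s * (1 - 1 / s))"
    using A' pos by simp
  ultimately have "R' * A s < R s * (A s / s) + R s * (A s * (1 - 1 / s))" by linarith
  also have "\<dots> = R s * A s" by (simp add: algebra_simps)
  finally have "R' < R s" using pos by simp
  then have "(\<lambda>p. b p + s * var_dir j p + 1 * par_dir j p) \<in> cone"
    using cone_par_dir_iff[of j "\<lambda>p. b p + s * var_dir j p" 1] cb j i \<open>i \<noteq> j\<close>
    by (simp add: R'_def R_def b_def)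
  then show ?thesis by (simp add: b_def add_ac)
qed

section \<open>Running the barrier argument from the all-ones vector\<close>

lemma cone_sum:
  assumes "finite M" "M \<noteq> {}" "\<And>m. m \<in> M \<Longrightarrow> f m \<in> cone"
  shows "(\<lambda>p. \<Sum>m\<in>M. f m p) \<in> cone"
  using assms by (induction M rule: finite_ne_induct) (auto simp: cone_add)

lemma sum_var_dir: "(\<Sum>j\<in>{1..n}. var_dir j p) = ones p"
  by (cases p) (auto simp: var_dir_def ones_def)

lemma partition_fun_real_1: "partition_fun_real n mu (\<lambda>_. 1) = 1"
  using prob by (simp add: partition_fun_real_def prob_measure_on_def)

lemma val_shift_ones:
  assumes l: "l \<in> {1..k}"
  shows "val (shift (l, i) c ones) = partition_fun_real n mu (\<lambda>j. if j = i then 1 + c else 1)"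
proof -
  have "mixed n (\<lambda>p. complex_of_real (shift (l, i) c ones p)) =
      (\<Prod>l'=1..k. P (\<lambda>j. complex_of_real (shift (l, i) c ones (l', j))))"
    using l by (intro mixed_eq_prod) (simp add: shift_other)
  also have "\<dots> = (\<Prod>l'=1..k. if l' = l then P (\<lambda>j. complex_of_real (if j = i then 1 + c else 1)) else 1)"
  proof (intro prod.cong refl)
    fix l' assume l': "l' \<in> {1..k}"
    have "P (\<lambda>j. complex_of_real (shift (l, i) c ones (l', j))) =
        P (\<lambda>j. complex_of_real (if l' = l \<and> j = i then 1 + c else 1))"
      using l' by (intro partition_fun_cong) (auto simp: shift_def)
    also have "\<dots> = (if l' = l then P (\<lambda>j. complex_of_real (if j = i then 1 + c else 1)) else 1)"
      using partition_fun_real_1 unfolding partition_fun_of_real by simp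
    finally show "P (\<lambda>j. complex_of_real (shift (l, i) c ones (l', j))) =
        (if l' = l then P (\<lambda>j. complex_of_real (if j = i then 1 + c else 1)) else 1)" .
  qed
  also have "\<dots> = P (\<lambda>j. complex_of_real (if j = i then 1 + c else 1))"
    using l by simp
  finally show ?thesis unfolding partition_fun_of_real of_real_val of_real_eq_iff .
qed

lemma val_ones: "val ones = 1"
proof -
  have "(\<lambda>j :: nat. if j = 0 then 1 + 0 else 1) = (\<lambda>_. 1 :: real)" by auto
  then show ?thesis using val_shift_ones[of 1 0 0] k partition_fun_real_1 by (simp add: shift_0)
qed

lemma slope_ones:
  "slope i ones = real k * (\<Sum>S\<in>{S\<in>Pow {1..n}. i \<in> S}. mu S)"
proof -
  \<comment> \<open>Doubling variable \<open>i\<close> doubles exactly the terms of sets containing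
    \<open>i\<close>, so each copy contributes the marginal once.\<close>
  have "partition_fun_real n mu (\<lambda>j. if j = i then 1 + 1 else 1) =
      (\<Sum>S\<in>Pow {1..n}. mu S + (if i \<in> S then mu S else 0))"
    unfolding partition_fun_real_def
  proof (intro sum.cong refl)
    fix S assume "S \<in> Pow {1..n}"
    then have "finite S" using finite_subset[of S "{1..n}"] by auto
    then show "mu S * (\<Prod>j\<in>S. if j = i then 1 + 1 else 1) = mu S + (if i \<in> S then mu S else 0)"
      by simp
  qed
  also have "\<dots> = 1 + (\<Sum>S\<in>{S\<in>Pow {1..n}. i \<in> S}. mu S)"
    using prob sum.inter_filter[of "Pow {1..n}" mu "\<lambda>S. i \<in> S"]
    unfolding prob_measure_on_def sum.distrib by simp
  finally show ?thesis by (simp add: slope_def val_shift_ones val_ones)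
qed

text \<open>By homogeneity the barrier at \<open>t\<close> times \<open>ones\<close> is that at
  \<open>ones\<close> divided by \<open>t\<close>, and the latter is \<open>k\<close> times the
  marginal of \<open>i\<close>.\<close>

lemma barrier_start:
  assumes i: "i \<in> {1..n}" and "y \<ge> 0" "t > 0"
    and less: "y * (real k * (\<Sum>S\<in>{S\<in>Pow {1..n}. i \<in> S}. mu S)) < t"
  shows "(\<lambda>p. t * ones p + y * par_dir i p) \<in> cone"
proof -
  have "y / t * slope i ones < val ones"
    using less assms unfolding slope_ones val_ones by (simp add: field_simps)
  then have "(\<lambda>p. ones p + y / t * par_dir i p) \<in> cone"
    using cone_par_dir_iff[of i ones "y / t"] i direction_in_cone assms by simp
  from cone_scale[OF this \<open>t > 0\<close>] show ?thesis using \<open>t > 0\<close> by (simp add: distrib_left)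
qed

text \<open>The invariant keeps room \<open>s / (s - 1)\<close> at every \<open>i\<close> outside
  \<open>L\<close>: each step spends the room at \<open>j\<close> and preserves it at the
  others.\<close>

lemma barrier_iterate:
  assumes s: "s > 1"
    and start: "\<And>i. i \<in> {1..n} \<Longrightarrow> (\<lambda>p. t * ones p + s / (s - 1) * par_dir i p) \<in> cone"
    and "finite L" "L \<subseteq> {1..n}" "i \<in> {1..n} - L"
  shows "(\<lambda>p. t * ones p + (\<Sum>j\<in>L. s * var_dir j p + par_dir j p) + s / (s - 1) * par_dir i p) \<in> cone"
  using assms(3-5)
proof (induction L arbitrary: i)
  case empty
  then show ?case using start by simp
next
  case (insert j L)
  define a where "a p = t * ones p + (\<Sum>j\<in>L. s * var_dir j p + par_dir j p)" for p
  have a0: "a (0, l) = 0" if "l \<notin> L" for l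
    using that insert(1) by (simp add: a_def)
  have "(\<lambda>p. a p + (s * var_dir j p + par_dir j p) + s / (s - 1) * par_dir i p) \<in> cone"
  proof (rule barrier_step)
    show "(\<lambda>p. a p + s / (s - 1) * par_dir i p) \<in> cone"
      unfolding a_def by (rule insert.IH) (use insert.prems in auto)
    show "(\<lambda>p. a p + s / (s - 1) * par_dir j p) \<in> cone"
      unfolding a_def by (rule insert.IH) (use insert.prems insert.hyps in auto)
    show "a (0, i) = 0" "a (0, j) = 0" using insert.prems insert.hyps by (auto intro: a0)
  qed (use insert.prems s in auto)
  moreover have "(\<Sum>j\<in>insert j L. s * var_dir j p + par_dir j p) =
      s * var_dir j p + par_dir j p + (\<Sum>j\<in>L. s * var_dir j p + par_dir j p)" for p
    using insert.hyps by simp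
  ultimately show ?case by (simp add: a_def add_ac)
qed

text \<open>The last variable needs no shift: instead its parameter may grow from \<open>1\<close> to \<open>s / (s - 1)\<close>.
  Adding up over the choice of the last variable makes the point symmetric.\<close>

lemma barrier_symmetrized:
  assumes s: "s > 1" and n: "n \<ge> 1"
    and start: "\<And>i. i \<in> {1..n} \<Longrightarrow> (\<lambda>p. t * ones p + s / (s - 1) * par_dir i p) \<in> cone"
  defines "\<tau> \<equiv> (real n * t + (real n - 1) * s) / (real n - 1 + s / (s - 1))"
  shows "(\<lambda>p. \<tau> * ones p + (\<Sum>j=1..n. par_dir j p)) \<in> cone"
proof -
  define y where "y = s / (s - 1)"
  have y: "y > 0" using s by (simp add: y_def)
  define f where "f m p = t * ones p + (\<Sum>j\<in>{1..n} - {m}. s * var_dir j p + par_dir j p) + y * par_dir m p"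
    for m p
  have "f m \<in> cone" if "m \<in> {1..n}" for m
    unfolding f_def[abs_def] y_def using that by (intro barrier_iterate s start) auto
  then have "(\<lambda>p. \<Sum>m\<in>{1..n}. f m p) \<in> cone" using n by (intro cone_sum) auto
  \<comment> \<open>Each \<open>var_dir j\<close> is missing from the summand \<open>m = j\<close>
    only; each parameter has weight 1 in \<open>n - 1\<close> summands and \<open>y\<close> in one.
    Scaling by the inverse of \<open>n - 1 + y\<close> brings all parameters to 1.\<close>
  moreover have "(\<Sum>m\<in>{1..n}. f m p) =
      (real n - 1 + y) * (\<tau> * ones p + (\<Sum>j=1..n. par_dir j p))" for p
  proof -
    have "(\<Sum>j\<in>{1..n} - {m}. s * var_dir j p + par_dir j p) =
        s * ones p + (\<Sum>j=1..n. par_dir j p) - (s * var_dir m p + par_dir m p)" if "m \<in> {1..n}" for m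
      using that by (simp add: sum_diff1 sum.distrib sum_distrib_left[symmetric] sum_var_dir
          right_diff_distrib del: One_nat_def)
    then have "(\<Sum>m\<in>{1..n}. f m p) = (\<Sum>m\<in>{1..n}. t * ones p + (s * ones p + (\<Sum>j=1..n. par_dir j p)
        - (s * var_dir m p + par_dir m p)) + y * par_dir m p)"
      by (intro sum.cong refl) (simp add: f_def)
    also have "\<dots> = real n * t * ones p + (real n - 1) * s * ones p + (real n - 1 + y) * (\<Sum>j=1..n. par_dir j p)"
      by (simp add: sum.distrib sum_subtractf sum_distrib_left[symmetric] sum_var_dir algebra_simps del: One_nat_def)
    also have "real n * t * ones p + (real n - 1) * s * ones p = (real n - 1 + y) * (\<tau> * ones p)"
      unfolding \<tau>_def y_def[symmetric] using y n by (simp add: field_simps)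
    finally show ?thesis by (simp add: distrib_left)
  qed
  ultimately have "(\<lambda>p. (real n - 1 + y) * (\<tau> * ones p + (\<Sum>j=1..n. par_dir j p))) \<in> cone" by simp
  from cone_scale[OF this, of "1 / (real n - 1 + y)"] show ?thesis using y n by simp
qed

subsection \<open>Choosing the partition\<close>

text \<open>Parameter 1 means averaging the shifts by \<open>- k\<close>, so some shifted value is
  positive. Affine interpolation between it and the positive \<open>val a\<close> has no zero, and
  \<open>cone_segment\<close> applies.\<close>

lemma cone_select_copy:
  assumes j: "j \<in> {1..n}" "a (0, j) = 0" and c: "(\<lambda>p. a p + par_dir j p) \<in> cone"
  obtains i where "i \<in> {1..k}" "shift (i, j) (- real k) a \<in> cone"
proof -
  have a: "a \<in> cone" using cone_sub_par_dir[OF c, of 1 j] by simp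
  have "(\<Sum>i=1..k. val (shift (i, j) (- real k) a)) / real k > 0"
    using val_parameter_average[of j a 1] j cone_val_pos[OF c] by simp
  then have "(\<Sum>i=1..k. val (shift (i, j) (- real k) a)) > 0"
    using k by (simp add: zero_less_divide_iff)
  then obtain i where i: "i \<in> {1..k}" "val (shift (i, j) (- real k) a) > 0"
    using sum_nonpos[of "{1..k}" "\<lambda>i. val (shift (i, j) (- real k) a)"] by (meson not_le)
  have "shift (i, j) (- real k) a \<in> cone"
  proof (rule cone_segment[OF a])
    fix r :: real assume r: "0 \<le> r" "r \<le> 1"
    have "(\<lambda>p. (1 - r) * a p + r * shift (i, j) (- real k) a p) = shift (i, j) (r * (- real k)) a"
      by (auto simp: shift_def fun_eq_iff algebra_simps)
    then have "val (\<lambda>p. (1 - r) * a p + r * shift (i, j) (- real k) a p) =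
        (1 - r) * val a + r * val (shift (i, j) (- real k) a)"
      using val_affine[OF i(1), of j "r * (- real k)" a] val_affine[OF i(1), of j "- real k" a]
      by (simp only:) (simp add: algebra_simps)
    moreover have "(1 - r) * val a + r * val (shift (i, j) (- real k) a) > 0"
    proof (cases "r = 0")
      case False
      then show ?thesis using r i(2) cone_val_pos[OF a] by (intro add_nonneg_pos) auto
    qed (use cone_val_pos[OF a] in simp)
    ultimately show "val (\<lambda>p. (1 - r) * a p + r * shift (i, j) (- real k) a p) \<noteq> 0" by simp
  qed
  then show thesis using that i by blast
qed

lemma cone_select_all:
  assumes c: "(\<lambda>p. \<tau> * ones p + (\<Sum>j=1..n. par_dir j p)) \<in> cone"
    and "finite L" "L \<subseteq> {1..n}"
  shows "\<exists>c. (\<forall>j\<in>L. c j \<in> {1..k}) \<and>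
    (\<lambda>p. \<tau> * ones p - (\<Sum>j\<in>L. if p = (c j, j) then real k else 0) + (\<Sum>j\<in>{1..n} - L. par_dir j p)) \<in> cone"
  using assms(2,3)
proof (induction L)
  case empty
  then show ?case using c by simp
next
  case (insert j L)
  obtain c where c: "\<forall>j\<in>L. c j \<in> {1..k}" and
    cone: "(\<lambda>p. \<tau> * ones p - (\<Sum>j\<in>L. if p = (c j, j) then real k else 0) + (\<Sum>j\<in>{1..n} - L. par_dir j p)) \<in> cone"
    using insert.IH insert.prems by auto
  define a where "a p = \<tau> * ones p - (\<Sum>j\<in>L. if p = (c j, j) then real k else 0)
      + (\<Sum>j\<in>{1..n} - insert j L. par_dir j p)" for p
  have "(\<Sum>j\<in>{1..n} - L. par_dir j p) = (\<Sum>j\<in>{1..n} - insert j L. par_dir j p) + par_dir j p" for p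
  proof -
    have *: "{1..n} - L = insert j ({1..n} - insert j L)" using insert.prems insert.hyps by auto
    show ?thesis by (subst *) (simp add: add.commute)
  qed
  then have "(\<lambda>p. a p + par_dir j p) \<in> cone" using cone by (simp add: a_def add_ac)
  moreover have "a (0, j) = 0"
  proof -
    have "(\<Sum>l\<in>L. if (0, j) = (c l, l) then real k else 0) = 0"
      using insert.hyps by (intro sum.neutral) auto
    moreover have "(\<Sum>l\<in>{1..n} - insert j L. par_dir l (0, j)) = 0"
      by (intro sum.neutral) auto
    ultimately show ?thesis by (simp add: a_def)
  qed
  ultimately obtain i where i: "i \<in> {1..k}" "shift (i, j) (- real k) a \<in> cone"
    using cone_select_copy[of j a] insert.prems by auto
  have "shift (i, j) (- real k) a = (\<lambda>p. \<tau> * ones p - (\<Sum>l\<in>insert j L. if p = ((c(j := i)) l, l) then real k else 0)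
      + (\<Sum>j\<in>{1..n} - insert j L. par_dir j p))"
  proof
    fix p
    have "(\<Sum>l\<in>L. if p = ((c(j := i)) l, l) then real k else 0) = (\<Sum>l\<in>L. if p = (c l, l) then real k else 0)"
      using insert.hyps by (intro sum.cong) auto
    then show "shift (i, j) (- real k) a p = \<tau> * ones p - (\<Sum>l\<in>insert j L. if p = ((c(j := i)) l, l) then real k else 0)
      + (\<Sum>j\<in>{1..n} - insert j L. par_dir j p)"
      using insert.hyps by (simp add: a_def shift_def)
  qed
  then have "(\<lambda>p. \<tau> * ones p - (\<Sum>l\<in>insert j L. if p = ((c(j := i)) l, l) then real k else 0)
      + (\<Sum>j\<in>{1..n} - insert j L. par_dir j p)) \<in> cone"
    using i(2) by simp
  moreover have "\<forall>l\<in>insert j L. (c(j := i)) l \<in> {1..k}" using c i insert.hyps by auto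
  ultimately show ?case by blast
qed

text \<open>Cone membership covers all \<open>t \<ge> \<tau>\<close> at once through the direction
  \<open>ones\<close>. With all parameters 0 the polynomial is the product of the copies, so no
  factor vanishes.\<close>

lemma assignment_exists:
  assumes c: "(\<lambda>p. \<tau> * ones p + (\<Sum>j=1..n. par_dir j p)) \<in> cone"
  obtains c where "c \<in> {1..n} \<rightarrow>\<^sub>E {1..k}"
    "\<And>i t. i \<in> {1..k} \<Longrightarrow> t \<ge> \<tau> \<Longrightarrow>
      partition_fun_real n mu (\<lambda>j. t - real k * e_set {j\<in>{1..n}. c j = i} j) \<noteq> 0"
proof -
  from cone_select_all[OF c, of "{1..n}"] obtain c where c: "\<forall>j\<in>{1..n}. c j \<in> {1..k}" and
    cone: "(\<lambda>p. \<tau> * ones p - (\<Sum>j=1..n. if p = (c j, j) then real k else 0)) \<in> cone"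
    by auto
  have "partition_fun_real n mu (\<lambda>j. t - real k * e_set {j\<in>{1..n}. c j = i} j) \<noteq> 0"
    if i: "i \<in> {1..k}" and t: "t \<ge> \<tau>" for i t
  proof -
    have "val (\<lambda>p. \<tau> * ones p - (\<Sum>j=1..n. if p = (c j, j) then real k else 0) + (t - \<tau>) * ones p) \<noteq> 0"
      using cone t unfolding cone_def by auto
    then have "mixed n (\<lambda>p. complex_of_real (t * ones p - (\<Sum>j=1..n. if p = (c j, j) then real k else 0))) \<noteq> 0"
      unfolding of_real_val by (simp add: algebra_simps)
    also have "mixed n (\<lambda>p. complex_of_real (t * ones p - (\<Sum>j=1..n. if p = (c j, j) then real k else 0))) =
        (\<Prod>i=1..k. P (\<lambda>j. complex_of_real (t * ones (i, j) - (\<Sum>l=1..n. if (i, j) = (c l, l) then real k else 0))))"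
    proof (rule mixed_eq_prod)
      fix j assume "j \<in> {1..n}"
      have "0 \<noteq> c l" if "l \<in> {1..n}" for l using c that by fastforce
      then have "(\<Sum>l=1..n. if (0, j) = (c l, l) then real k else 0) = 0"
        by (intro sum.neutral ballI) (simp only: prod.inject simp_thms if_False)
      then show "complex_of_real (t * ones (0, j) - (\<Sum>l=1..n. if (0, j) = (c l, l) then real k else 0)) = 0"
        by simp
    qed
    finally have "P (\<lambda>j. complex_of_real (t * ones (i, j) - (\<Sum>l=1..n. if (i, j) = (c l, l) then real k else 0))) \<noteq> 0"
      using i by (auto simp: prod_zero_iff)
    also have "P (\<lambda>j. complex_of_real (t * ones (i, j) - (\<Sum>l=1..n. if (i, j) = (c l, l) then real k else 0))) =
        P (\<lambda>j. complex_of_real (t - real k * e_set {j\<in>{1..n}. c j = i} j))"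
    proof (rule partition_fun_cong)
      fix j assume j: "j \<in> {1..n}"
      have "(\<Sum>l=1..n. if (i, j) = (c l, l) then real k else 0) = (\<Sum>l=1..n. if l = j then if c j = i then real k else 0 else 0)"
        by (intro sum.cong) auto
      also have "\<dots> = (if c j = i then real k else 0)" using j by simp
      finally show "complex_of_real (t * ones (i, j) - (\<Sum>l=1..n. if (i, j) = (c l, l) then real k else 0)) =
          complex_of_real (t - real k * e_set {j\<in>{1..n}. c j = i} j)"
        using i j by (simp add: e_set_def)
    qed
    finally show ?thesis unfolding partition_fun_of_real by simp
  qed
  \<comment> \<open>Restricting \<open>c\<close> places the assignment in a finite set of
    functions.\<close>
  then have "partition_fun_real n mu (\<lambda>j. t - real k * e_set {j\<in>{1..n}. restrict c {1..n} j = i} j) \<noteq> 0"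
    if "i \<in> {1..k}" "t \<ge> \<tau>" for i t
  proof -
    have "{j\<in>{1..n}. restrict c {1..n} j = i} = {j\<in>{1..n}. c j = i}" by auto
    then show ?thesis using that \<open>\<And>i t. i \<in> {1..k} \<Longrightarrow> t \<ge> \<tau> \<Longrightarrow> partition_fun_real n mu
      (\<lambda>j. t - real k * e_set {j\<in>{1..n}. c j = i} j) \<noteq> 0\<close> by metis
  qed
  then show thesis using c that[of "restrict c {1..n}"] by (simp add: PiE_iff)
qed

text \<open>The assignment may depend on \<tau>, but only finitely many exist. If each failed at
  some \<open>t c > T\<close>, a \<tau> not above any of these would yield an assignment
  contradicting its own failure.\<close>

lemma uniform_assignment_exists:
  assumes "\<And>\<tau>. \<tau> > T \<Longrightarrow> (\<lambda>p. \<tau> * ones p + (\<Sum>j=1..n. par_dir j p)) \<in> cone"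
  obtains c where "c \<in> {1..n} \<rightarrow>\<^sub>E {1..k}"
    "\<And>i t. i \<in> {1..k} \<Longrightarrow> t > T \<Longrightarrow>
      partition_fun_real n mu (\<lambda>j. t - real k * e_set {j\<in>{1..n}. c j = i} j) \<noteq> 0"
proof (rule ccontr)
  define C where "C = {1..n} \<rightarrow>\<^sub>E {1..k}"
  define bad where "bad c t \<longleftrightarrow> (\<exists>i\<in>{1..k}.
      partition_fun_real n mu (\<lambda>j. t - real k * e_set {j\<in>{1..n}. c j = i} j) = 0)" for c t
  assume "\<not> thesis"
  then have "\<forall>c\<in>C. \<exists>t>T. bad c t" using that unfolding C_def bad_def by metis
  then obtain t where t: "\<And>c. c \<in> C \<Longrightarrow> t c > T" "\<And>c. c \<in> C \<Longrightarrow> bad c (t c)" by metis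
  have fin: "finite C" by (simp add: C_def finite_PiE)
  define \<tau> where "\<tau> = Min (insert (T + 1) (t ` C))"
  have "\<tau> > T" using fin t by (auto simp: \<tau>_def)
  from assignment_exists[OF assms[OF this]] obtain c where c: "c \<in> C"
    "\<And>i t. i \<in> {1..k} \<Longrightarrow> t \<ge> \<tau> \<Longrightarrow>
      partition_fun_real n mu (\<lambda>j. t - real k * e_set {j\<in>{1..n}. c j = i} j) \<noteq> 0"
    unfolding C_def by blast
  from c(1) have "t c \<ge> \<tau>" using fin by (auto simp: \<tau>_def)
  from t(2)[OF c(1)]
  obtain i where "i \<in> {1..k}" and
    zero: "partition_fun_real n mu (\<lambda>j. t c - real k * e_set {j\<in>{1..n}. c j = i} j) = 0"
    unfolding bad_def by blast
  from c(2)[OF this(1) \<open>t c \<ge> \<tau>\<close>] zero show False by contradiction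
qed

end

section \<open>Eigenvalues\<close>

lemma partition_fun_real_homogeneous:
  assumes "constant_sum n mu d"
  shows "partition_fun_real n mu (\<lambda>j. c * x j) = c ^ d * partition_fun_real n mu x"
proof -
  have "complex_of_real (partition_fun_real n mu (\<lambda>j. c * x j)) = of_real (c ^ d * partition_fun_real n mu x)"
    using partition_fun_homogeneous[OF assms, of "of_real c" "\<lambda>j. of_real (x j)"]
    by (simp flip: partition_fun_of_real)
  then show ?thesis by (simp only: of_real_eq_iff)
qed

lemma partition_fun_real_pos:
  assumes "prob_measure_on n mu" "\<And>j. j \<in> {1..n} \<Longrightarrow> x j > 0"
  shows "partition_fun_real n mu x > 0"
proof -
  have nonneg: "\<And>S. S \<in> Pow {1..n} \<Longrightarrow> 0 \<le> mu S" and "(\<Sum>S\<in>Pow {1..n}. mu S) = 1"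
    using assms(1) by (auto simp: prob_measure_on_def)
  then obtain S where S: "S \<in> Pow {1..n}" "mu S \<noteq> 0"
    by (metis sum.neutral zero_neq_one)
  have pos: "(\<Prod>j\<in>S. x j) > 0" if "S \<in> Pow {1..n}" for S
    using that assms(2) by (intro prod_pos) auto
  show ?thesis
    unfolding partition_fun_real_def
  proof (rule sum_pos2[of _ S])
    have "mu S > 0" using S nonneg[OF S(1)] by simp
    then show "mu S * prod x S > 0" using pos[OF S(1)] by simp
    show "0 \<le> mu S * prod x S" if "S \<in> Pow {1..n}" for S
      using nonneg[OF that] pos[OF that] by simp
  qed (use S in auto)
qed

lemma finite_eigenvalues:
  assumes "prob_measure_on n mu"
  shows "finite (eigenvalues n mu x)"
proof -
  define p where "p = (\<Sum>S\<in>Pow {1..n}. smult (mu S) (\<Prod>j\<in>S. [:- x j, 1:]))"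
  have p: "poly p t = partition_fun_real n mu (\<lambda>j. t - x j)" for t
    by (simp add: p_def partition_fun_real_def poly_sum poly_prod)
  define t where "t = Max (insert 0 (x ` {1..n})) + 1"
  have "t - x j > 0" if "j \<in> {1..n}" for j
  proof -
    have "x j \<le> Max (insert 0 (x ` {1..n}))" using that by (intro Max_ge) auto
    then show ?thesis by (simp add: t_def)
  qed
  then have "poly p t > 0" unfolding p by (intro partition_fun_real_pos assms)
  then have "p \<noteq> 0" by auto
  from poly_roots_finite[OF this] show ?thesis by (simp add: eigenvalues_def p)
qed

text \<open>For \<open>t < 0\<close> all coordinates \<open>e_set S j - t\<close> are positive;
  negating them changes the polynomial only by a sign.\<close>

lemma eigenvalues_e_set_nonneg:
  assumes "prob_measure_on n mu" "constant_sum n mu d" "t \<in> eigenvalues n mu (e_set S)"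
  shows "t \<ge> 0"
proof (rule ccontr)
  assume "\<not> t \<ge> 0"
  then have "partition_fun_real n mu (\<lambda>j. e_set S j - t) > 0"
    by (intro partition_fun_real_pos assms) (auto simp: e_set_def)
  moreover have "partition_fun_real n mu (\<lambda>j. t - e_set S j) = (- 1) ^ d * partition_fun_real n mu (\<lambda>j. e_set S j - t)"
    using partition_fun_real_homogeneous[OF assms(2), of "- 1" "\<lambda>j. e_set S j - t"] by simp
  ultimately show False using assms(3) by (simp add: eigenvalues_def)
qed

lemma hnorm_e_set:
  assumes "prob_measure_on n mu" "constant_sum n mu d"
  shows "hnorm n mu (e_set S) = lambda_max n mu (e_set S)"
proof -
  have "abs ` eigenvalues n mu (e_set S) = eigenvalues n mu (e_set S)"
    using eigenvalues_e_set_nonneg[OF assms, of _ S] by force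
  then show ?thesis by (simp add: hnorm_def lambda_max_def)
qed

text \<open>\<open>b \<ge> 0\<close> takes care of the default value 0 of an empty spectrum.\<close>

lemma lambda_max_le:
  assumes "prob_measure_on n mu" "b \<ge> 0" "\<And>t. t \<in> eigenvalues n mu x \<Longrightarrow> t \<le> b"
  shows "lambda_max n mu x \<le> b"
  using assms finite_eigenvalues[OF assms(1), of x] by (auto simp: lambda_max_def)

text \<open>Double counting of the expected size of a random set. It supplies the lower bound on
  \<epsilon> behind the hypothesis of \<open>optimal_barrier\<close>.\<close>

lemma sum_marginals:
  assumes "prob_measure_on n mu" "constant_sum n mu d"
  shows "(\<Sum>i=1..n. \<Sum>S\<in>{S\<in>Pow {1..n}. i \<in> S}. mu S) = real d"
proof -
  have "(\<Sum>i=1..n. \<Sum>S\<in>{S\<in>Pow {1..n}. i \<in> S}. mu S) =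
      (\<Sum>i=1..n. \<Sum>S\<in>Pow {1..n}. if i \<in> S then mu S else 0)"
    by (intro sum.cong refl sum.inter_filter) simp
  also have "\<dots> = (\<Sum>S\<in>Pow {1..n}. \<Sum>i=1..n. if i \<in> S then mu S else 0)"
    by (rule sum.swap)
  also have "\<dots> = (\<Sum>S\<in>Pow {1..n}. real d * mu S)"
  proof (intro sum.cong refl)
    fix S assume S: "S \<in> Pow {1..n}"
    have "(\<Sum>i=1..n. if i \<in> S then mu S else 0) = (\<Sum>i\<in>{1..n} \<inter> S. mu S)"
      by (rule sum.inter_restrict[symmetric]) simp
    also have "{1..n} \<inter> S = S" using S by auto
    also have "(\<Sum>i\<in>S. mu S) = real d * mu S"
      using S assms(2) by (cases "mu S = 0") (auto simp: constant_sum_def)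
    finally show "(\<Sum>i=1..n. if i \<in> S then mu S else 0) = real d * mu S" .
  qed
  also have "\<dots> = real d"
    using assms(1) by (simp add: sum_distrib_left[symmetric] prob_measure_on_def)
  finally show ?thesis .
qed

lemma eigenvalues_empty:
  assumes "prob_measure_on n mu" "constant_sum n mu 0"
  shows "eigenvalues n mu x = {}"
proof -
  \<comment> \<open>Scaling by 0, with \<open>0 ^ 0 = 1\<close>, shows that the polynomial is
    constant.\<close>
  have "partition_fun_real n mu z = partition_fun_real n mu (\<lambda>_. 0)" for z
    using partition_fun_real_homogeneous[OF assms(2), of 0 z] by simp
  then have "partition_fun_real n mu z = partition_fun_real n mu (\<lambda>_. 1)" for z by metis
  then have "partition_fun_real n mu z \<noteq> 0" for z
    using partition_fun_real_pos[OF assms(1), of "\<lambda>_. 1"] by (metis less_irrefl zero_less_one)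
  then show ?thesis by (simp add: eigenvalues_def)
qed

text \<open>The value \<open>s = 1 - a + w\<close> minimises the bound \<open>\<tau>\<close> of \<open>barrier_symmetrized\<close>, which then equals \<open>s\<^sup>2\<close>.\<close>

lemma optimal_barrier:
  fixes N \<alpha> :: real
  assumes "N > 0"
  defines "a \<equiv> 1 / N"
  assumes "\<alpha> > a"
  defines "w \<equiv> sqrt (\<alpha> - a * (1 - a))"
  defines "s \<equiv> 1 - a + w"
  shows "s > 1" "N * (s / (s - 1) * \<alpha>) + (N - 1) * s = s\<^sup>2 * (N - 1 + s / (s - 1))"
proof -
  have aN: "a * N = 1" "a > 0" using assms by auto
  \<comment> \<open>A rewriting of \<open>\<alpha> > a\<close>; it makes the radicand positive and
    gives \<open>w > a\<close>, hence \<open>s > 1\<close>.\<close>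
  have "a\<^sup>2 < \<alpha> - a * (1 - a)" using assms by (simp add: power2_eq_square algebra_simps)
  then have "a < w" unfolding w_def using aN by (simp add: real_less_rsqrt)
  then show "s > 1" by (simp add: s_def)
  have w2: "w\<^sup>2 = \<alpha> - a * (1 - a)"
    unfolding w_def using \<open>a\<^sup>2 < _\<close> by (intro real_sqrt_pow2) (smt (verit) zero_le_power2)
  define u where "u = s - 1"
  have u: "u > 0" "u = w - a" using \<open>s > 1\<close> by (auto simp: u_def s_def)
  define y where "y = s / u"
  have yu: "y * u = s" using u by (simp add: y_def)
  have "(N - 1 + y) * u = N * w"
  proof -
    have "(N - 1 + y) * u = N * u - u + y * u" by (simp add: algebra_simps)
    also have "\<dots> = N * u + 1" by (simp add: yu) (simp add: u_def)
    also have "\<dots> = N * w" using aN(1) by (simp add: u(2) algebra_simps)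
    finally show ?thesis .
  qed
  moreover have "(N * (y * \<alpha>) + (N - 1) * s) * u = s\<^sup>2 * (N * w)"
  proof -
    have \<alpha>: "N * \<alpha> = N * w\<^sup>2 + (1 - a)" using aN(1) by (simp add: w2 algebra_simps)
    have "(N * (y * \<alpha>) + (N - 1) * s) * u = (y * u) * (N * \<alpha>) + (N - 1) * u * s"
      by (simp add: algebra_simps)
    also have "\<dots> = s * (N * w\<^sup>2 + (1 - a) + (N - 1) * (w - a))"
      unfolding yu \<alpha> by (simp add: u(2) algebra_simps)
    also have "N * w\<^sup>2 + (1 - a) + (N - 1) * (w - a) = N * w * s"
      using aN(1) by (simp add: s_def algebra_simps power2_eq_square)
    finally show ?thesis by (simp add: power2_eq_square)
  qed
  ultimately have "(N * (y * \<alpha>) + (N - 1) * s) * u = s\<^sup>2 * (N - 1 + y) * u"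
    by (simp add: mult.assoc)
  then show "N * (s / (s - 1) * \<alpha>) + (N - 1) * s = s\<^sup>2 * (N - 1 + s / (s - 1))"
    using u(1) by (simp add: y_def u_def)
qed

theorem theorem8p1:
  fixes k n d :: nat and \<epsilon> :: real and mu :: "nat set \<Rightarrow> real"
  assumes "k \<ge> 2" and "\<epsilon> > 0"
    and "prob_measure_on n mu"
    and "strong_rayleigh n mu"
    and "constant_sum n mu d"
    and "\<forall>i\<in>{1..n}. (\<Sum>S\<in>{S\<in>Pow {1..n}. i \<in> S}. mu S) \<le> \<epsilon>"
  shows "\<exists>P :: nat \<Rightarrow> nat set.
           (\<Union>i\<in>{1..k}. P i) = {1..n} \<and>
           (\<forall>i\<in>{1..k}. \<forall>j\<in>{1..k}. i \<noteq> j \<longrightarrow> P i \<inter> P j = {}) \<and>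
           (\<forall>i\<in>{1..k}. hnorm n mu (e_set (P i)) = lambda_max n mu (e_set (P i)) \<and>
                        lambda_max n mu (e_set (P i)) \<le> 1 / real k * delta (real k * \<epsilon>) n)"
proof (cases "d = 0")
  case True
  \<comment> \<open>For \<open>d = 0\<close> there are no eigenvalues, so \<open>lambda_max\<close>
    is 0 by convention and one block may take everything.\<close>
  have nonneg: "0 \<le> 1 / real k * delta (real k * \<epsilon>) n" by (simp add: delta_def)
  have "lambda_max n mu x = 0" for x
    using eigenvalues_empty[of n mu x] assms True by (simp add: lambda_max_def)
  then show ?thesis
    using nonneg \<open>k \<ge> 2\<close> hnorm_e_set[OF assms(3,5)]
    by (intro exI[of _ "\<lambda>i. if i = 1 then {1..n} else {}"]) auto
next
  case False
  interpret rayleigh_copies n k d mu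
    using assms by unfold_locales auto
  \<comment> \<open>As \<open>d \<ge> 1\<close>, this gives \<open>n * \<epsilon> \<ge> 1\<close>,
    and \<open>k \<ge> 2\<close> makes the inequality for \<alpha> strict.\<close>
  have "real d \<le> real n * \<epsilon>"
    using sum_bounded_above[of "{1..n}" "\<lambda>i. \<Sum>S\<in>{S\<in>Pow {1..n}. i \<in> S}. mu S" \<epsilon>] assms(6)
    unfolding sum_marginals[OF assms(3,5)] by simp
  then have "1 \<le> real n * \<epsilon>" using False by linarith
  then have n: "real n > 0" using not_le by fastforce
  define \<alpha> where "\<alpha> = real k * \<epsilon>"
  have "real n * \<epsilon> < real n * \<alpha>" using n assms by (simp add: \<alpha>_def)
  with \<open>1 \<le> real n * \<epsilon>\<close> have "1 < real n * \<alpha>" by linarith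
  then have \<alpha>: "\<alpha> > 1 / real n" using n by (simp add: divide_less_eq mult.commute)
  define s where "s = 1 - 1 / real n + sqrt (\<alpha> - 1 / real n * (1 - 1 / real n))"
  have s: "s > 1" and opt: "real n * (s / (s - 1) * \<alpha>) + (real n - 1) * s = s\<^sup>2 * (real n - 1 + s / (s - 1))"
    unfolding s_def using optimal_barrier[OF n \<alpha>] by blast+
  have delta: "delta (real k * \<epsilon>) n = s\<^sup>2" by (simp add: delta_def s_def \<alpha>_def)
  have "(\<lambda>p. \<tau> * ones p + (\<Sum>j=1..n. par_dir j p)) \<in> cone" if \<tau>: "\<tau> > s\<^sup>2" for \<tau>
  proof -
    define y where "y = s / (s - 1)"
    have y: "y > 0" using s by (simp add: y_def)
    \<comment> \<open>Chosen so that \<open>barrier_symmetrized\<close> returns exactly \<tau>. By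
      \<open>opt\<close>, \<open>y * \<alpha>\<close> is this expression at
      \<open>s\<^sup>2\<close>, so a larger \<tau> leaves the strict room that
      \<open>barrier_start\<close> asks for.\<close>
    define t where "t = (\<tau> * (real n - 1 + y) - (real n - 1) * s) / real n"
    have "real n \<ge> 1" using n by simp
    then have pos: "real n - 1 + y > 0" using y by linarith
    have "real n * (y * \<alpha>) = s\<^sup>2 * (real n - 1 + y) - (real n - 1) * s"
      using opt by (simp add: y_def)
    also have "\<dots> < \<tau> * (real n - 1 + y) - (real n - 1) * s"
      using \<tau> pos by simp
    finally have less: "y * \<alpha> < t" using n by (simp add: t_def field_simps)
    have "(\<lambda>p. t * ones p + y * par_dir i p) \<in> cone" if i: "i \<in> {1..n}" for i
    proof (rule barrier_start[OF i])
      show "y \<ge> 0" using y by simp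
      have "y * \<alpha> > 0" using y assms by (simp add: \<alpha>_def)
      then show "t > 0" using less by linarith
      have "y * (real k * (\<Sum>S\<in>{S\<in>Pow {1..n}. i \<in> S}. mu S)) \<le> y * \<alpha>"
        unfolding \<alpha>_def using y assms i by (intro mult_left_mono) auto
      then show "y * (real k * (\<Sum>S\<in>{S\<in>Pow {1..n}. i \<in> S}. mu S)) < t" using less by linarith
    qed
    from barrier_symmetrized[OF s _ this[unfolded y_def]] n
    have "(\<lambda>p. (real n * t + (real n - 1) * s) / (real n - 1 + y) * ones p + (\<Sum>j=1..n. par_dir j p)) \<in> cone"
      by (simp add: y_def)
    moreover have "(real n * t + (real n - 1) * s) / (real n - 1 + y) = \<tau>"
      using n pos by (simp add: t_def)
    ultimately show ?thesis by simp
  qed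
  from uniform_assignment_exists[OF this] obtain c where c: "c \<in> {1..n} \<rightarrow>\<^sub>E {1..k}"
    "\<And>i t. i \<in> {1..k} \<Longrightarrow> t > s\<^sup>2 \<Longrightarrow>
      partition_fun_real n mu (\<lambda>j. t - real k * e_set {j\<in>{1..n}. c j = i} j) \<noteq> 0"
    by blast
  define S where "S i = {j\<in>{1..n}. c j = i}" for i
  have "lambda_max n mu (e_set (S i)) \<le> 1 / real k * s\<^sup>2" if i: "i \<in> {1..k}" for i
  proof (rule lambda_max_le[OF assms(3)])
    fix t assume t: "t \<in> eigenvalues n mu (e_set (S i))"
    show "t \<le> 1 / real k * s\<^sup>2"
    proof (rule ccontr)
      assume "\<not> t \<le> 1 / real k * s\<^sup>2"
      \<comment> \<open>The copies were shifted by \<open>k\<close>, so an eigenvalue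
        \<open>t\<close> of the block is a zero at \<open>k * t\<close>; homogeneity takes the
        factor out.\<close>
      then have "real k * t > s\<^sup>2" using k by (simp add: field_simps)
      from c(2)[OF i this] have "partition_fun_real n mu (\<lambda>j. real k * (t - e_set (S i) j)) \<noteq> 0"
        by (simp add: S_def right_diff_distrib)
      then show False
        using t unfolding partition_fun_real_homogeneous[OF assms(5)] by (simp add: eigenvalues_def)
    qed
  qed simp
  moreover have "(\<Union>i\<in>{1..k}. S i) = {1..n}" using c(1) by (auto simp: S_def)
  moreover have "\<forall>i\<in>{1..k}. \<forall>j\<in>{1..k}. i \<noteq> j \<longrightarrow> S i \<inter> S j = {}" by (auto simp: S_def)
  ultimately show ?thesis
    unfolding delta using hnorm_e_set[OF assms(3,5)] by (intro exI[of _ S]) auto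
qed

end
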